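(* Let $T$ be a countable complete theory with monster model $\mathcal{U}$, $M\prec\mathcal{U}$ a small model, and $\mu\in\mathfrak{M}_x(\mathcal{U})$ a Keisler measure. Then $\mu$ is both sequentially approximated over $M$ and definable over $M$ if and only if $\mu$ is finitely approximated over $M$.
   Context: $T$ is a complete first-order theory in a countable language $\mathcal{L}$, $\mathcal{U}$ is a monster model (sufficiently saturated and strongly homogeneous). $\mathfrak{M}_x(\mathcal{U})$ is the space of Keisler measures, i.e. finitely additive probability measures on the Boolean algebra $\mathcal{L}_x(\mathcal{U})$ of formulas in the finite tuple of variables $x$ with parameters from $\mathcal{U}$, with the topology of pointwise convergence on formulas. $(M^x)^{<\omega}$ is the set of finite (nonempty) sequences of points of $M^x$; for $\overline{a}=(a_1,\dots,a_n)$, $\operatorname{Av}(\overline{a})(\psi(x))=\frac1n|\{1\le i\le n:\mathcal{U}\models\psi(a_i)\}|$. $\mu$ is sequentially approximated over $M$ if there is a sequence $(\overline{a}_i)_{i\in\omega}$ in $(M^x)^{<\omega}$ with $\lim_{i\to\infty}\operatorname{Av}(\overline{a}_i)=\mu$ in $\mathfrak{M}_x(\mathcal{U})$. $\mu$ is $M$-invariant if for every $\mathcal{L}$-formula $\varphi(x,y)$ and $b,b'\in\mathcal{U}^y$ with $b\equiv_M b'$, $\mu(\varphi(x,b))=\mu(\varphi(x,b'))$. $\mu$ is definable over $M$ if it is $M$-invariant and for every $\mathcal{L}$-formula $\varphi(x,y)$ the map $F_\mu^\varphi:S_y(M)\to[0,1]$, $F_\mu^\varphi(q)=\mu(\varphi(x,b))$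 for any $b\models q$, is continuous. $\mu$ is finitely approximated over $M$ if for every $\mathcal{L}$-formula $\varphi(x,y)$ and every $\epsilon>0$ there is $\overline{a}\in(M^x)^{<\omega}$ with $\sup_{b\in\mathcal{U}^y}|\mu(\varphi(x,b))-\operatorname{Av}(\overline{a})(\varphi(x,b))|<\epsilon$. *)

theory Defs
  imports "HOL-Analysis.Analysis" "HOL-Library.NList"
begin

unbundle cardinal_syntax

section \<open>First-order logic\<close>

text \<open>A language consists of sets of symbols, not of whole types, so that empty and finite
  languages are included.  The arities of symbols outside these sets are irrelevant.\<close>

record ('f, 'r) lang =
  funs :: "'f set"
  rels :: "'r set"
  farity :: "'f \<Rightarrow> nat"
  rarity :: "'r \<Rightarrow> nat"

datatype 'f tm = Var nat | Fn 'f "'f tm list"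

datatype ('f, 'r) fm =
    Tru
  | Eq "'f tm" "'f tm"
  | Rel 'r "'f tm list"
  | Neg "('f, 'r) fm"
  | Disj "('f, 'r) fm" "('f, 'r) fm"
  | Ex nat "('f, 'r) fm"

abbreviation Fls :: "('f, 'r) fm" where
  "Fls \<equiv> Neg Tru"

abbreviation Conj :: "('f, 'r) fm \<Rightarrow> ('f, 'r) fm \<Rightarrow> ('f, 'r) fm" where
  "Conj \<phi> \<psi> \<equiv> Neg (Disj (Neg \<phi>) (Neg \<psi>))"

fun wf_tm :: "('f, 'r) lang \<Rightarrow> 'f tm \<Rightarrow> bool" where
  "wf_tm L (Var v) \<longleftrightarrow> True"
| "wf_tm L (Fn f ts) \<longleftrightarrow> f \<in> funs L \<and> length ts = farity L f \<and> (\<forall>t\<in>set ts. wf_tm L t)"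

fun wf_fm :: "('f, 'r) lang \<Rightarrow> ('f, 'r) fm \<Rightarrow> bool" where
  "wf_fm L Tru \<longleftrightarrow> True"
| "wf_fm L (Eq s t) \<longleftrightarrow> wf_tm L s \<and> wf_tm L t"
| "wf_fm L (Rel r ts) \<longleftrightarrow> r \<in> rels L \<and> length ts = rarity L r \<and> (\<forall>t\<in>set ts. wf_tm L t)"
| "wf_fm L (Neg \<phi>) \<longleftrightarrow> wf_fm L \<phi>"
| "wf_fm L (Disj \<phi> \<psi>) \<longleftrightarrow> wf_fm L \<phi> \<and> wf_fm L \<psi>"
| "wf_fm L (Ex v \<phi>) \<longleftrightarrow> wf_fm L \<phi>"

fun fv_tm :: "'f tm \<Rightarrow> nat set" where
  "fv_tm (Var v) = {v}"
| "fv_tm (Fn f ts) = (\<Union>t\<in>set ts. fv_tm t)"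

fun fv :: "('f, 'r) fm \<Rightarrow> nat set" where
  "fv Tru = {}"
| "fv (Eq s t) = fv_tm s \<union> fv_tm t"
| "fv (Rel r ts) = (\<Union>t\<in>set ts. fv_tm t)"
| "fv (Neg \<phi>) = fv \<phi>"
| "fv (Disj \<phi> \<psi>) = fv \<phi> \<union> fv \<psi>"
| "fv (Ex v \<phi>) = fv \<phi> - {v}"

definition formulas :: "('f, 'r) lang \<Rightarrow> nat set \<Rightarrow> ('f, 'r) fm set" where
  "formulas L X = {\<phi>. wf_fm L \<phi> \<and> fv \<phi> \<subseteq> X}"

record ('f, 'r, 'u) struct =
  carr :: "'u set"
  fint :: "'f \<Rightarrow> 'u list \<Rightarrow> 'u"
  rint :: "'r \<Rightarrow> 'u list \<Rightarrow> bool"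

definition is_struct :: "('f, 'r) lang \<Rightarrow> ('f, 'r, 'u) struct \<Rightarrow> bool" where
  "is_struct L S \<longleftrightarrow> carr S \<noteq> {} \<and>
     (\<forall>f\<in>funs L. \<forall>as\<in>nlists (farity L f) (carr S). fint S f as \<in> carr S)"

fun eval_tm :: "('f, 'r, 'u) struct \<Rightarrow> (nat \<Rightarrow> 'u) \<Rightarrow> 'f tm \<Rightarrow> 'u" where
  "eval_tm S e (Var v) = e v"
| "eval_tm S e (Fn f ts) = fint S f (map (eval_tm S e) ts)"

fun sat :: "('f, 'r, 'u) struct \<Rightarrow> (nat \<Rightarrow> 'u) \<Rightarrow> ('f, 'r) fm \<Rightarrow> bool" where
  "sat S e Tru \<longleftrightarrow> True"
| "sat S e (Eq s t) \<longleftrightarrow> eval_tm S e s = eval_tm S e t"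
| "sat S e (Rel r ts) \<longleftrightarrow> rint S r (map (eval_tm S e) ts)"
| "sat S e (Neg \<phi>) \<longleftrightarrow> \<not> sat S e \<phi>"
| "sat S e (Disj \<phi> \<psi>) \<longleftrightarrow> sat S e \<phi> \<or> sat S e \<psi>"
| "sat S e (Ex v \<phi>) \<longleftrightarrow> (\<exists>u\<in>carr S. sat S (e(v := u)) \<phi>)"

definition models :: "('f, 'r, 'u) struct \<Rightarrow> ('f, 'r) fm set \<Rightarrow> bool" where
  "models S T \<longleftrightarrow> (\<forall>\<phi>\<in>T. \<forall>e. range e \<subseteq> carr S \<longrightarrow> sat S e \<phi>)"

text \<open>Semantic consequence, tested on models whose carrier is a set of natural numbers.
  For a countable language this is the usual notion, by the downward Loewenheim-Skolem
  theorem.\<close>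

definition entails :: "('f, 'r) lang \<Rightarrow> ('f, 'r) fm set \<Rightarrow> ('f, 'r) fm \<Rightarrow> bool" where
  "entails L T \<phi> \<longleftrightarrow>
     (\<forall>N :: ('f, 'r, nat) struct. is_struct L N \<and> models N T \<longrightarrow> models N {\<phi>})"

definition complete_theory :: "('f, 'r) lang \<Rightarrow> ('f, 'r) fm set \<Rightarrow> bool" where
  "complete_theory L T \<longleftrightarrow> T \<subseteq> formulas L {} \<and> \<not> entails L T Fls \<and>
     (\<forall>\<phi>\<in>formulas L {}. entails L T \<phi> \<or> entails L T (Neg \<phi>))"

definition elem_substruct ::
  "('f, 'r) lang \<Rightarrow> ('f, 'r, 'u) struct \<Rightarrow> ('f, 'r, 'u) struct \<Rightarrow> bool" where
  "elem_substruct L M U \<longleftrightarrow> is_struct L M \<and> carr M \<subseteq> carr U \<and>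
     (\<forall>f\<in>funs L. \<forall>as\<in>nlists (farity L f) (carr M). fint M f as = fint U f as) \<and>
     (\<forall>r\<in>rels L. \<forall>as\<in>nlists (rarity L r) (carr M). rint M r as = rint U r as) \<and>
     (\<forall>\<phi>\<in>formulas L UNIV. \<forall>e. range e \<subseteq> carr M \<longrightarrow> (sat M e \<phi> \<longleftrightarrow> sat U e \<phi>))"


section \<open>Tuples of variables and parameters\<close>

text \<open>A finite tuple of variables is a distinct list \<open>ys\<close> of variable names; the set
  \<open>A\<^sup>y\<close> is \<open>nlists (length ys) A\<close>.  The assignment \<open>assign ys b\<close> is unspecified
  outside \<open>ys\<close>, and is used only for formulas with free variables in \<open>ys\<close>.\<close>

abbreviation tuples :: "nat list \<Rightarrow> 'u set \<Rightarrow> 'u list set" where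
  "tuples ys A \<equiv> nlists (length ys) A"

definition assign :: "nat list \<Rightarrow> 'u list \<Rightarrow> nat \<Rightarrow> 'u" where
  "assign ys b = (\<lambda>v. the (map_of (zip ys b) v))"

text \<open>The language \<open>L(A)\<close> has a new constant symbol \<open>Inr a\<close> for each \<open>a \<in> A\<close>,
  and \<open>U\<close> is expanded by interpreting each \<open>Inr a\<close> as \<open>a\<close>.\<close>

definition lang_params :: "('f, 'r) lang \<Rightarrow> 'u set \<Rightarrow> ('f + 'u, 'r) lang" where
  "lang_params L A = \<lparr>funs = funs L <+> A, rels = rels L,
     farity = case_sum (farity L) (\<lambda>_. 0), rarity = rarity L\<rparr>"

definition expand :: "('f, 'r, 'u) struct \<Rightarrow> ('f + 'u, 'r, 'u) struct" where
  "expand U = \<lparr>carr = carr U, fint = case_sum (fint U) (\<lambda>a _. a), rint = rint U\<rparr>"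

abbreviation formulas_over ::
  "('f, 'r) lang \<Rightarrow> nat list \<Rightarrow> 'u set \<Rightarrow> ('f + 'u, 'r) fm set" where
  "formulas_over L ys A \<equiv> formulas (lang_params L A) (set ys)"

definition holds ::
  "('f, 'r, 'u) struct \<Rightarrow> nat list \<Rightarrow> ('f + 'u, 'r) fm \<Rightarrow> 'u list \<Rightarrow> bool" where
  "holds U ys \<phi> b \<longleftrightarrow> sat (expand U) (assign ys b) \<phi>"

fun subst_tm :: "(nat \<Rightarrow> 'u option) \<Rightarrow> 'f tm \<Rightarrow> ('f + 'u) tm" where
  "subst_tm \<sigma> (Var v) = (case \<sigma> v of None \<Rightarrow> Var v | Some a \<Rightarrow> Fn (Inr a) [])"
| "subst_tm \<sigma> (Fn f ts) = Fn (Inl f) (map (subst_tm \<sigma>) ts)"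

fun subst_fm :: "(nat \<Rightarrow> 'u option) \<Rightarrow> ('f, 'r) fm \<Rightarrow> ('f + 'u, 'r) fm" where
  "subst_fm \<sigma> Tru = Tru"
| "subst_fm \<sigma> (Eq s t) = Eq (subst_tm \<sigma> s) (subst_tm \<sigma> t)"
| "subst_fm \<sigma> (Rel r ts) = Rel r (map (subst_tm \<sigma>) ts)"
| "subst_fm \<sigma> (Neg \<phi>) = Neg (subst_fm \<sigma> \<phi>)"
| "subst_fm \<sigma> (Disj \<phi> \<psi>) = Disj (subst_fm \<sigma> \<phi>) (subst_fm \<sigma> \<psi>)"
| "subst_fm \<sigma> (Ex v \<phi>) = Ex v (subst_fm (\<sigma>(v := None)) \<phi>)"

text \<open>\<open>plug ys \<phi> b\<close> is the formula \<open>\<phi>(x, b)\<close> with parameters, for an \<open>L\<close>-formula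
  \<open>\<phi>(x, y)\<close>.\<close>

definition plug :: "nat list \<Rightarrow> ('f, 'r) fm \<Rightarrow> 'u list \<Rightarrow> ('f + 'u, 'r) fm" where
  "plug ys \<phi> b = subst_fm (map_of (zip ys b)) \<phi>"

text \<open>The pairs \<open>(\<phi>, ys)\<close> such that \<open>\<phi>\<close> is an \<open>L\<close>-formula \<open>\<phi>(x, y)\<close>.\<close>

definition partitioned :: "('f, 'r) lang \<Rightarrow> nat list \<Rightarrow> (('f, 'r) fm \<times> nat list) set" where
  "partitioned L xs = {(\<phi>, ys). distinct ys \<and> set xs \<inter> set ys = {} \<and>
     \<phi> \<in> formulas L (set xs \<union> set ys)}"


section \<open>Types, saturation and homogeneity\<close>

definition tp :: "('f, 'r) lang \<Rightarrow> ('f, 'r, 'u) struct \<Rightarrow> nat list \<Rightarrow> 'u set \<Rightarrow> 'u list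
    \<Rightarrow> ('f + 'u, 'r) fm set" where
  "tp L U ys A b = {\<phi> \<in> formulas_over L ys A. holds U ys \<phi> b}"

definition realizes :: "('f, 'r, 'u) struct \<Rightarrow> nat list \<Rightarrow> 'u list
    \<Rightarrow> ('f + 'u, 'r) fm set \<Rightarrow> bool" where
  "realizes U ys b q \<longleftrightarrow> b \<in> tuples ys (carr U) \<and> (\<forall>\<phi>\<in>q. holds U ys \<phi> b)"

text \<open>\<open>S\<^sub>y(A)\<close>: consistency with the theory of \<open>U\<close> over \<open>A\<close> is finite
  satisfiability in \<open>U\<close>.\<close>

definition types :: "('f, 'r) lang \<Rightarrow> ('f, 'r, 'u) struct \<Rightarrow> nat list \<Rightarrow> 'u set
    \<Rightarrow> ('f + 'u, 'r) fm set set" where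
  "types L U ys A = {q. q \<subseteq> formulas_over L ys A \<and>
     (\<forall>q0. finite q0 \<and> q0 \<subseteq> q \<longrightarrow> (\<exists>b. realizes U ys b q0)) \<and>
     (\<forall>\<phi>\<in>formulas_over L ys A. \<phi> \<in> q \<or> Neg \<phi> \<in> q)}"

definition type_space :: "('f, 'r) lang \<Rightarrow> ('f, 'r, 'u) struct \<Rightarrow> nat list \<Rightarrow> 'u set
    \<Rightarrow> ('f + 'u, 'r) fm set topology" where
  "type_space L U ys A =
     topology_generated_by ((\<lambda>\<phi>. {q \<in> types L U ys A. \<phi> \<in> q}) ` formulas_over L ys A)"

definition saturated :: "'k rel \<Rightarrow> ('f, 'r) lang \<Rightarrow> ('f, 'r, 'u) struct \<Rightarrow> bool" where
  "saturated \<kappa> L U \<longleftrightarrow> (\<forall>A ys q. A \<subseteq> carr U \<and> |A| <o \<kappa> \<and> distinct ys \<and>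
     q \<in> types L U ys A \<longrightarrow> (\<exists>b. realizes U ys b q))"

definition elementary_on ::
  "('f, 'r) lang \<Rightarrow> ('f, 'r, 'u) struct \<Rightarrow> 'u set \<Rightarrow> ('u \<Rightarrow> 'u) \<Rightarrow> bool" where
  "elementary_on L U A g \<longleftrightarrow> g ` A \<subseteq> carr U \<and>
     (\<forall>\<phi>\<in>formulas L UNIV. \<forall>e. range e \<subseteq> A \<longrightarrow> (sat U e \<phi> \<longleftrightarrow> sat U (g \<circ> e) \<phi>))"

definition automorphism ::
  "('f, 'r) lang \<Rightarrow> ('f, 'r, 'u) struct \<Rightarrow> ('u \<Rightarrow> 'u) \<Rightarrow> bool" where
  "automorphism L U g \<longleftrightarrow> bij_betw g (carr U) (carr U) \<and>
     (\<forall>f\<in>funs L. \<forall>as\<in>nlists (farity L f) (carr U). g (fint U f as) = fint U f (map g as)) \<and>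
     (\<forall>r\<in>rels L. \<forall>as\<in>nlists (rarity L r) (carr U). rint U r as \<longleftrightarrow> rint U r (map g as))"

definition strongly_homogeneous ::
  "'k rel \<Rightarrow> ('f, 'r) lang \<Rightarrow> ('f, 'r, 'u) struct \<Rightarrow> bool" where
  "strongly_homogeneous \<kappa> L U \<longleftrightarrow> (\<forall>A g. A \<subseteq> carr U \<and> |A| <o \<kappa> \<and> elementary_on L U A g \<longrightarrow>
     (\<exists>h. automorphism L U h \<and> (\<forall>a\<in>A. h a = g a)))"

text \<open>The degree \<open>\<kappa>\<close> of saturation and homogeneity is an arbitrary uncountable cardinal;
  a set of parameters is small if its cardinality is below \<open>\<kappa>\<close>.\<close>

definition monster ::
  "'k rel \<Rightarrow> ('f, 'r) lang \<Rightarrow> ('f, 'r) fm set \<Rightarrow> ('f, 'r, 'u) struct \<Rightarrow> bool" where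
  "monster \<kappa> L T U \<longleftrightarrow> is_struct L U \<and> models U T \<and> Card_order \<kappa> \<and> natLeq <o \<kappa> \<and>
     saturated \<kappa> L U \<and> strongly_homogeneous \<kappa> L U"


section \<open>Keisler measures\<close>

text \<open>The Boolean algebra of formulas identifies formulas that are equivalent in \<open>U\<close>, so a
  measure on it is a function of formulas respecting this equivalence.  Measures are
  \<open>extensional\<close>, i.e. have a fixed dummy value off the formulas over \<open>U\<close> in \<open>x\<close>, so that
  equality of functions is equality of measures.\<close>

definition keisler :: "('f, 'r) lang \<Rightarrow> ('f, 'r, 'u) struct \<Rightarrow> nat list
    \<Rightarrow> (('f + 'u, 'r) fm \<Rightarrow> real) set" where
  "keisler L U xs = {\<mu> \<in> extensional (formulas_over L xs (carr U)).
     (\<forall>\<phi>\<in>formulas_over L xs (carr U). 0 \<le> \<mu> \<phi>) \<and>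
     \<mu> Tru = 1 \<and>
     (\<forall>\<phi>\<in>formulas_over L xs (carr U). \<forall>\<psi>\<in>formulas_over L xs (carr U).
        (\<forall>a\<in>tuples xs (carr U). holds U xs \<phi> a \<longleftrightarrow> holds U xs \<psi> a) \<longrightarrow> \<mu> \<phi> = \<mu> \<psi>) \<and>
     (\<forall>\<phi>\<in>formulas_over L xs (carr U). \<forall>\<psi>\<in>formulas_over L xs (carr U).
        (\<forall>a\<in>tuples xs (carr U). \<not> holds U xs (Conj \<phi> \<psi>) a) \<longrightarrow>
        \<mu> (Disj \<phi> \<psi>) = \<mu> \<phi> + \<mu> \<psi>)}"

definition keisler_space :: "('f, 'r) lang \<Rightarrow> ('f, 'r, 'u) struct \<Rightarrow> nat list
    \<Rightarrow> (('f + 'u, 'r) fm \<Rightarrow> real) topology" where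
  "keisler_space L U xs = subtopology
     (product_topology (\<lambda>_. euclideanreal) (formulas_over L xs (carr U))) (keisler L U xs)"

definition Av :: "('f, 'r) lang \<Rightarrow> ('f, 'r, 'u) struct \<Rightarrow> nat list \<Rightarrow> 'u list list
    \<Rightarrow> ('f + 'u, 'r) fm \<Rightarrow> real" where
  "Av L U xs as = restrict
     (\<lambda>\<psi>. real (card {i. i < length as \<and> holds U xs \<psi> (as ! i)}) / real (length as))
     (formulas_over L xs (carr U))"

definition point_seqs :: "nat list \<Rightarrow> 'u set \<Rightarrow> 'u list list set" where
  "point_seqs xs A = {as. as \<noteq> [] \<and> set as \<subseteq> tuples xs A}"

definition sequentially_approximated :: "('f, 'r) lang \<Rightarrow> ('f, 'r, 'u) struct \<Rightarrow> nat list
    \<Rightarrow> 'u set \<Rightarrow> (('f + 'u, 'r) fm \<Rightarrow> real) \<Rightarrow> bool" where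
  "sequentially_approximated L U xs A \<mu> \<longleftrightarrow>
     (\<exists>as :: nat \<Rightarrow> 'u list list. (\<forall>i. as i \<in> point_seqs xs A) \<and>
        limitin (keisler_space L U xs) (\<lambda>i. Av L U xs (as i)) \<mu> sequentially)"

definition invariant :: "('f, 'r) lang \<Rightarrow> ('f, 'r, 'u) struct \<Rightarrow> nat list
    \<Rightarrow> 'u set \<Rightarrow> (('f + 'u, 'r) fm \<Rightarrow> real) \<Rightarrow> bool" where
  "invariant L U xs A \<mu> \<longleftrightarrow> (\<forall>(\<phi>, ys)\<in>partitioned L xs.
     \<forall>b\<in>tuples ys (carr U). \<forall>b'\<in>tuples ys (carr U).
       tp L U ys A b = tp L U ys A b' \<longrightarrow> \<mu> (plug ys \<phi> b) = \<mu> (plug ys \<phi> b'))"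

text \<open>For small \<open>A\<close> and \<open>A\<close>-invariant \<open>\<mu>\<close>, every \<open>q\<close> in \<open>S\<^sub>y(A)\<close> is realized and the
  value below does not depend on the chosen realization.\<close>

definition fiber_map :: "('f, 'r, 'u) struct \<Rightarrow> (('f + 'u, 'r) fm \<Rightarrow> real)
    \<Rightarrow> ('f, 'r) fm \<Rightarrow> nat list \<Rightarrow> ('f + 'u, 'r) fm set \<Rightarrow> real" where
  "fiber_map U \<mu> \<phi> ys q = \<mu> (plug ys \<phi> (SOME b. realizes U ys b q))"

definition definable :: "('f, 'r) lang \<Rightarrow> ('f, 'r, 'u) struct \<Rightarrow> nat list
    \<Rightarrow> 'u set \<Rightarrow> (('f + 'u, 'r) fm \<Rightarrow> real) \<Rightarrow> bool" where
  "definable L U xs A \<mu> \<longleftrightarrow> invariant L U xs A \<mu> \<and>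
     (\<forall>(\<phi>, ys)\<in>partitioned L xs.
        continuous_map (type_space L U ys A) (top_of_set {0..1}) (fiber_map U \<mu> \<phi> ys))"

definition finitely_approximated :: "('f, 'r) lang \<Rightarrow> ('f, 'r, 'u) struct \<Rightarrow> nat list
    \<Rightarrow> 'u set \<Rightarrow> (('f + 'u, 'r) fm \<Rightarrow> real) \<Rightarrow> bool" where
  "finitely_approximated L U xs A \<mu> \<longleftrightarrow>
     (\<forall>(\<phi>, ys)\<in>partitioned L xs. \<forall>\<epsilon>>0. \<exists>as\<in>point_seqs xs A.
        (SUP b\<in>tuples ys (carr U).
           \<bar>\<mu> (plug ys \<phi> b) - Av L U xs as (plug ys \<phi> b)\<bar>) < \<epsilon>)"

end

theory Submission
  imports Defs
begin

text \<open>
  Fix a formula \<open>\<phi>(x, y)\<close> and write \<open>F(b) = \<mu>(\<phi>(x, b))\<close> and, for a finite sequence \<open>as\<close> of points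
  of \<open>M\<close>, \<open>G(b) = Av(as)(\<phi>(x, b))\<close>.  For a point \<open>a\<close> of \<open>M\<close>, the condition that \<open>\<phi>(a, b)\<close> holds
  depends only on the type of \<open>b\<close> over \<open>M\<close> and defines a clopen subset of the type space
  \<open>S\<^sub>y(M)\<close>.  So \<open>G\<close> is a locally constant function on \<open>S\<^sub>y(M)\<close>.

  Suppose that \<open>\<mu>\<close> is finitely approximated.  Then \<open>F\<close> is a uniform limit of such functions,
  hence constant on types over \<open>M\<close> and continuous, which is definability
  (\<open>definable_if_finitely_approximated\<close>).  For a sequential approximation, enumerate the
  countably many formulas \<open>\<phi>(x, y)\<close>; the \<open>n\<close>-th sequence of points should approximate the first
  \<open>n\<close> formulas within \<open>1/n\<close> simultaneously.  Finite approximation deals with one formula at a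
  time, but finitely many formulas can be coded into one, with extra variables in \<open>y\<close> that
  select the formula (\<open>ex_common_instances\<close>).  The coding needs two different elements; over a
  structure with a single element all measures agree.

  Conversely let \<open>Av(as\<^sub>i)\<close> converge to \<open>\<mu>\<close> and let \<open>\<mu>\<close> be definable.  With \<open>G\<^sub>i\<close> formed from
  \<open>as\<^sub>i\<close>, the functions \<open>|G\<^sub>i - F|\<close> are continuous on the compact space \<open>S\<^sub>y(M)\<close>, are bounded by 1,
  and tend to 0 pointwise, but in general not uniformly.  As in Mazur's lemma, suitable convex
  combinations of them are uniformly small.  This is \<open>midpoint_hull_uniformly_small\<close>, obtained
  from the elementary argument behind Simons' inequality, without representing functionals as
  measures.  That argument uses only iterated midpoints as convex combinations.  Since the
  midpoint of two averages of points is again an average of points (\<open>ex_Av_midpoint\<close>), a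
  midpoint combination with values below \<open>\<epsilon>\<close> yields one sequence of points that approximates
  \<open>F\<close> within \<open>\<epsilon>\<close>.
\<close>

(* nlistsE_length is the rule that a member of nlists n A has length n. Rewriting with it turns
   every goal of the form length b = n into a search for A, which does not terminate once
   membership in nlists is itself rewritten to the length. *)
declare nlistsE_length [simp del] nlistsE_set [simp del]


section \<open>Uniformly small midpoint combinations of a pointwise null sequence\<close>

text \<open>Iterated midpoints, with addition and halving taken pointwise; these are the convex
  combinations of members of \<open>S\<close> with dyadic weights.\<close>

inductive_set midpoint_hull :: "('a \<Rightarrow> real) set \<Rightarrow> ('a \<Rightarrow> real) set" for S where
  base: "f \<in> S \<Longrightarrow> f \<in> midpoint_hull S"
| mid: "f \<in> midpoint_hull S \<Longrightarrow> g \<in> midpoint_hull S \<Longrightarrow> (\<lambda>x. (f x + g x) / 2) \<in> midpoint_hull S"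

lemma midpoint_hull_le:
  assumes "g \<in> midpoint_hull S" "\<And>f. f \<in> S \<Longrightarrow> f x \<le> c"
  shows "g x \<le> c"
  using assms by (induction rule: midpoint_hull.induct) fastforce+

lemma midpoint_hull_ge:
  assumes "g \<in> midpoint_hull S" "\<And>f. f \<in> S \<Longrightarrow> c \<le> f x"
  shows "c \<le> g x"
  using assms by (induction rule: midpoint_hull.induct) fastforce+

lemma midpoint_hull_mono: "S \<subseteq> S' \<Longrightarrow> midpoint_hull S \<subseteq> midpoint_hull S'"
proof
  fix g assume "g \<in> midpoint_hull S" "S \<subseteq> S'"
  then show "g \<in> midpoint_hull S'"
    by (induction rule: midpoint_hull.induct) (auto intro: midpoint_hull.intros)
qed

lemma continuous_map_midpoint_hull:
  assumes "g \<in> midpoint_hull S" "\<And>f. f \<in> S \<Longrightarrow> continuous_map X euclideanreal f"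
  shows "continuous_map X euclideanreal g"
  using assms by (induction rule: midpoint_hull.induct) (auto intro!: continuous_intros)

lemma ex_near_minimizer:
  fixes F :: "'a \<Rightarrow> real"
  assumes "S \<noteq> {}" and "\<And>s. s \<in> S \<Longrightarrow> c \<le> F s" and "0 < e"
  obtains s where "s \<in> S" "\<And>t. t \<in> S \<Longrightarrow> F s \<le> F t + e"
proof -
  have bdd: "bdd_below (F ` S)"
    using assms(2) by (intro bdd_belowI2)
  have "Inf (F ` S) < Inf (F ` S) + e"
    using assms by simp
  then obtain s where s: "s \<in> S" "F s < Inf (F ` S) + e"
    using cInf_lessD[of "F ` S"] assms(1) by blast
  have "Inf (F ` S) \<le> F t" if "t \<in> S" for t
    using cInf_lower[OF _ bdd] that by blast
  then show ?thesis
    using that[OF s(1)] s(2) by (smt (verit))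
qed

lemma compact_space_attains_sup:
  fixes h :: "'a \<Rightarrow> real"
  assumes "compact_space X" "topspace X \<noteq> {}" "continuous_map X euclideanreal h"
  obtains y where "y \<in> topspace X" "\<And>x. x \<in> topspace X \<Longrightarrow> h x \<le> h y"
proof -
  have "compact (h ` topspace X)"
    using image_compactin[OF _ assms(3), of "topspace X"] assms(1) by (simp add: compact_space_def)
  then show ?thesis
    using compact_attains_sup[of "h ` topspace X"] assms(2) that by auto
qed

lemma continuous_map_dominated_series:
  fixes g :: "nat \<Rightarrow> 'a \<Rightarrow> real"
  assumes cont: "\<And>k. continuous_map X euclideanreal (g k)"
    and dom: "\<And>k x. x \<in> topspace X \<Longrightarrow> \<bar>g k x\<bar> \<le> M k" and "summable M"
  shows "continuous_map X euclideanreal (\<lambda>x. \<Sum>k. g k x)"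
proof -
  have "uniform_limit (topspace X) (\<lambda>n x. \<Sum>k<n. g k x) (\<lambda>x. \<Sum>k. g k x) sequentially"
    using Weierstrass_m_test[of "topspace X" g M] dom \<open>summable M\<close> by simp
  then have "continuous_map X Met_TC.mtopology (\<lambda>x. \<Sum>k. g k x)"
    by (intro Met_TC.continuous_map_uniform_limit[where F = sequentially and f = "\<lambda>n x. \<Sum>k<n. g k x"])
      (auto simp: uniform_limit_iff intro!: always_eventually continuous_map_sum cont)
  then show ?thesis
    by simp
qed

text \<open>Suppose that no function in the hull is smaller than \<open>\<epsilon>\<close> everywhere, so that \<open>p(g) \<ge> \<epsilon>\<close> for the
  supremum \<open>p\<close> and all \<open>g\<close> in the hull.  Let \<open>S\<^sub>n\<close> be the hull of \<open>f\<^sub>n, f\<^sub>n\<^sub>+\<^sub>1, ...\<close>.  Put \<open>h\<^sub>0 = 0\<close> and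
  \<open>h\<^sub>n\<^sub>+\<^sub>1 = h\<^sub>n + g\<^sub>n / 2^(n+1)\<close>, where \<open>g\<^sub>n\<close> in \<open>S\<^sub>n\<close> nearly minimizes \<open>a\<^sub>n = p(h\<^sub>n + g\<^sub>n / 2^n)\<close>.  The
  midpoint of \<open>g\<^sub>n\<close> and \<open>g\<^sub>n\<^sub>+\<^sub>1\<close> competes with \<open>g\<^sub>n\<close> and gives the value \<open>a\<^sub>n\<^sub>+\<^sub>1\<close>, so \<open>a\<^sub>n\<close> is nearly
  increasing.  It starts at \<open>p(g\<^sub>0) \<ge> \<epsilon>\<close> and tends to \<open>p(H)\<close>, where \<open>H\<close> is the limit of the \<open>h\<^sub>n\<close>.
  Since \<open>h\<^sub>n\<^sub>+\<^sub>1\<close> is the midpoint of \<open>h\<^sub>n\<close> and \<open>h\<^sub>n + g\<^sub>n / 2^n\<close>, induction gives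
  \<open>h\<^sub>n \<le> (1 - 1/2^n) p(H)\<close> up to a small error of order \<open>1/2^n\<close>.  At a point \<open>y\<close> where the
  continuous function \<open>H\<close> attains its supremum, the tail \<open>H(y) - h\<^sub>n(y)\<close> is therefore at least
  about \<open>\<epsilon>/2^n\<close>.  But it is the sum of the terms \<open>g\<^sub>k(y)/2^(k+1)\<close> with \<open>k \<ge> n\<close>, and \<open>g\<^sub>k(y)\<close> is small
  because \<open>f\<^sub>k(y)\<close> tends to 0.\<close>

lemma midpoint_hull_uniformly_small:
  fixes f :: "nat \<Rightarrow> 'a \<Rightarrow> real"
  assumes X: "compact_space X"
    and cont: "\<And>n. continuous_map X euclideanreal (f n)"
    and bounds: "\<And>n x. x \<in> topspace X \<Longrightarrow> 0 \<le> f n x \<and> f n x \<le> 1"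
    and lim: "\<And>x. x \<in> topspace X \<Longrightarrow> (\<lambda>n. f n x) \<longlonglongrightarrow> 0"
    and "0 < \<epsilon>"
  shows "\<exists>g\<in>midpoint_hull (range f). \<forall>x\<in>topspace X. g x < \<epsilon>"
proof (rule ccontr)
  assume "\<not> ?thesis"
  then have large: "\<exists>x\<in>topspace X. \<epsilon> \<le> g x" if "g \<in> midpoint_hull (range f)" for g
    using that by (meson not_less)
  then have ne: "topspace X \<noteq> {}"
    by (metis base empty_iff rangeI)
  define S where "S n = midpoint_hull (f ` {n..})" for n
  define p where "p u = (SUP x\<in>topspace X. u x)" for u :: "'a \<Rightarrow> real"
  have S0: "S 0 = midpoint_hull (range f)"
    by (simp add: S_def atLeast_0)
  have S_ne: "f n \<in> S n" for n
    by (simp add: S_def base)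
  have S_mono: "S n \<subseteq> S m" if "m \<le> n" for m n
    unfolding S_def by (rule midpoint_hull_mono) (use that in auto)
  have S_bounds: "0 \<le> g x" "g x \<le> 1" if "g \<in> S n" "x \<in> topspace X" for g n x
    using midpoint_hull_ge[of g "f ` {n..}" 0 x] midpoint_hull_le[of g "f ` {n..}" x 1] that bounds
    by (auto simp: S_def)
  have p_upper: "u x \<le> p u" if "x \<in> topspace X" "\<And>x. x \<in> topspace X \<Longrightarrow> u x \<le> C" for u x C
    unfolding p_def using that by (intro cSUP_upper bdd_aboveI2) auto
  have p_least: "p u \<le> C" if "\<And>x. x \<in> topspace X \<Longrightarrow> u x \<le> C" for u C
    unfolding p_def using that ne by (intro cSUP_least) auto
  define \<delta> where "\<delta> = \<epsilon> / 8"
  have "0 < \<delta>"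
    using \<open>0 < \<epsilon>\<close> by (simp add: \<delta>_def)
  \<comment> \<open>The state of the recursion after \<open>n\<close> steps.  The tolerance \<open>\<delta> / 4 ^ n\<close> has to beat the
  weight \<open>1 / 2 ^ n\<close> of the tail that is estimated at the end.\<close>
  define good where "good n h g \<longleftrightarrow> g \<in> S n \<and> (\<forall>x\<in>topspace X. 0 \<le> h x \<and> h x \<le> 1 - 1 / 2 ^ n) \<and>
      (n = 0 \<longrightarrow> h = (\<lambda>_. 0)) \<and>
      (\<forall>g'\<in>S n. p (\<lambda>x. h x + g x / 2 ^ n) \<le> p (\<lambda>x. h x + g' x / 2 ^ n) + \<delta> / 4 ^ n)"
    for n h g
  have good_ex: "\<exists>g. good n h g"
    if h: "\<forall>x\<in>topspace X. 0 \<le> h x \<and> h x \<le> 1 - 1 / 2 ^ n" "n = 0 \<longrightarrow> h = (\<lambda>_. 0)" for n h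
  proof -
    obtain x0 where x0: "x0 \<in> topspace X"
      using ne by blast
    have "0 \<le> p (\<lambda>x. h x + g x / 2 ^ n)" if "g \<in> S n" for g
    proof -
      have "h x0 + g x0 / 2 ^ n \<le> p (\<lambda>x. h x + g x / 2 ^ n)"
      proof (rule p_upper[OF x0])
        fix x assume "x \<in> topspace X"
        then show "h x + g x / 2 ^ n \<le> 1"
          using h S_bounds[OF that] by (smt (verit) divide_right_mono zero_le_power)
      qed
      moreover have "0 \<le> h x0 + g x0 / 2 ^ n"
        using h(1) S_bounds[OF that] x0 by auto
      ultimately show ?thesis
        by simp
    qed
    then obtain g where "g \<in> S n"
      "\<And>g'. g' \<in> S n \<Longrightarrow> p (\<lambda>x. h x + g x / 2 ^ n) \<le> p (\<lambda>x. h x + g' x / 2 ^ n) + \<delta> / 4 ^ n"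
      using ex_near_minimizer[of "S n" 0 "\<lambda>g. p (\<lambda>x. h x + g x / 2 ^ n)" "\<delta> / 4 ^ n"]
        S_ne[of n] \<open>0 < \<delta>\<close> by auto
    then show ?thesis
      using h unfolding good_def by auto
  qed
  have "\<exists>s :: nat \<Rightarrow> ('a \<Rightarrow> real) \<times> ('a \<Rightarrow> real). \<forall>n. good n (fst (s n)) (snd (s n)) \<and>
      fst (s (Suc n)) = (\<lambda>x. fst (s n) x + snd (s n) x / 2 ^ Suc n)"
  proof (rule dependent_nat_choice)
    show "\<exists>s. good 0 (fst s) (snd s)"
      using good_ex[where n = 0 and h = "\<lambda>_. 0"] by auto
  next
    fix s :: "('a \<Rightarrow> real) \<times> ('a \<Rightarrow> real)" and n
    assume s: "good n (fst s) (snd s)"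
    let ?h = "\<lambda>x. fst s x + snd s x / 2 ^ Suc n"
    have "0 \<le> ?h x \<and> ?h x \<le> 1 - 1 / 2 ^ Suc n" if "x \<in> topspace X" for x
    proof -
      have "0 \<le> fst s x" "fst s x \<le> 1 - 1 / 2 ^ n" "snd s \<in> S n"
        using s that by (auto simp: good_def)
      moreover have "0 \<le> snd s x / 2 ^ Suc n" "snd s x / 2 ^ Suc n \<le> 1 / 2 ^ Suc n"
        using S_bounds[OF \<open>snd s \<in> S n\<close> that] by (auto simp: divide_right_mono)
      moreover have "1 / 2 ^ n = 2 * (1 / 2 ^ Suc n :: real)"
        by simp
      ultimately show ?thesis
        by linarith
    qed
    then obtain g where "good (Suc n) ?h g"
      using good_ex[where n = "Suc n" and h = ?h] by auto
    then show "\<exists>s'. good (Suc n) (fst s') (snd s') \<and> fst s' = ?h"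
      by (intro exI[of _ "(?h, g)"]) simp
  qed
  then obtain s :: "nat \<Rightarrow> ('a \<Rightarrow> real) \<times> ('a \<Rightarrow> real)"
    where s: "\<And>n. good n (fst (s n)) (snd (s n))"
      "\<And>n. fst (s (Suc n)) = (\<lambda>x. fst (s n) x + snd (s n) x / 2 ^ Suc n)"
    by blast
  define h g where "h n = fst (s n)" and "g n = snd (s n)" for n
  have g_S: "g n \<in> S n" for n
    using s(1) by (auto simp: good_def g_def)
  have h_0: "h 0 = (\<lambda>_. 0)"
    using s(1)[of 0] by (auto simp: good_def h_def)
  have h_Suc: "h (Suc n) x = h n x + g n x / 2 ^ Suc n" for n x
    using s(2) by (auto simp: h_def g_def)
  have h_bounds: "0 \<le> h n x" "h n x \<le> 1" if "x \<in> topspace X" for n x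
    using s(1)[of n] that by (auto simp: good_def h_def intro: order_trans)
  have g_min: "p (\<lambda>x. h n x + g n x / 2 ^ n) \<le> p (\<lambda>x. h n x + g' x / 2 ^ n) + \<delta> / 4 ^ n"
    if "g' \<in> S n" for n g'
    using s(1)[of n] that by (auto simp: good_def h_def g_def)
  have g_bounds: "0 \<le> g n x" "g n x \<le> 1" if "x \<in> topspace X" for n x
    using S_bounds[OF g_S that] by auto
  have h_sum: "h n x = (\<Sum>k<n. g k x / 2 ^ Suc k)" for n x
    by (induction n) (auto simp: h_0 h_Suc)
  define H where "H x = (\<Sum>k. g k x / 2 ^ Suc k)" for x
  have geo: "summable (\<lambda>k. 1 / 2 ^ Suc k :: real)"
    using sums_summable[OF power_half_series] by (simp add: power_divide)
  have H_sums: "(\<lambda>k. g k x / 2 ^ Suc k) sums H x" if "x \<in> topspace X" for x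
    unfolding H_def
    by (rule summable_sums, rule summable_comparison_test'[OF geo, of 0])
      (use g_bounds[OF that] in \<open>auto simp: divide_simps\<close>)
  have tail_sums: "(\<lambda>k. 1 / 2 ^ Suc (k + n)) sums (1 / 2 ^ n :: real)" for n
    using sums_mult[OF power_half_series, of "1 / 2 ^ n"] by (simp add: power_add power_divide mult_ac)
  have H_tail: "(\<lambda>k. g (k + n) x / 2 ^ Suc (k + n)) sums (H x - h n x)" if "x \<in> topspace X" for n x
    using sums_split_initial_segment[OF H_sums[OF that], of n] by (simp add: h_sum)
  have H_ge: "h n x \<le> H x" if "x \<in> topspace X" for n x
  proof -
    have "0 \<le> H x - h n x"
      by (rule sums_le[OF _ sums_zero H_tail[OF that, of n]]) (use g_bounds[OF that] in auto)
    then show ?thesis by simp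
  qed
  have H_le: "H x - h n x \<le> c / 2 ^ n" if "x \<in> topspace X" "\<And>k. n \<le> k \<Longrightarrow> g k x \<le> c" for n x c
  proof -
    have *: "(\<lambda>k. c * (1 / 2 ^ Suc (k + n))) sums (c * (1 / 2 ^ n))"
      by (rule sums_mult[OF tail_sums])
    have "H x - h n x \<le> c * (1 / 2 ^ n)"
      by (rule sums_le[OF _ H_tail[OF that(1)] *]) (use that(2) in \<open>auto simp: divide_right_mono\<close>)
    then show ?thesis by simp
  qed
  have H_bound: "H x \<le> 1" if "x \<in> topspace X" for x
    using H_le[OF that, of 0 1] g_bounds[OF that] by (simp add: h_0)
  define a where "a n = p (\<lambda>x. h n x + g n x / 2 ^ n)" for n
  have a_step: "a n \<le> a (Suc n) + \<delta> / 4 ^ n" for n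
  proof -
    let ?g = "\<lambda>x. (g n x + g (Suc n) x) / 2"
    have "g (Suc n) \<in> S n"
      using g_S[of "Suc n"] S_mono[of n "Suc n"] by auto
    then have "?g \<in> S n"
      using g_S[of n] by (auto simp: S_def intro: mid)
    then have "a n \<le> p (\<lambda>x. h n x + ?g x / 2 ^ n) + \<delta> / 4 ^ n"
      unfolding a_def by (rule g_min)
    also have "(\<lambda>x. h n x + ?g x / 2 ^ n) = (\<lambda>x. h (Suc n) x + g (Suc n) x / 2 ^ Suc n)"
      by (auto simp: h_Suc field_simps)
    finally show ?thesis
      by (simp add: a_def)
  qed
  have a_le: "a n \<le> p H + 1 / 2 ^ n" for n
    unfolding a_def
  proof (rule p_least)
    fix x assume x: "x \<in> topspace X"
    have "h n x \<le> p H"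
      using H_ge[OF x] p_upper[OF x, of H 1] H_bound by (meson order_trans)
    moreover have "g n x / 2 ^ n \<le> 1 / 2 ^ n"
      using g_bounds[OF x] by (simp add: divide_right_mono)
    ultimately show "h n x + g n x / 2 ^ n \<le> p H + 1 / 2 ^ n"
      by simp
  qed
  \<comment> \<open>The errors \<open>\<delta> / 4 ^ k\<close> of the single steps from \<open>n\<close> on sum up to \<open>4 / 3 * \<delta> / 4 ^ n\<close>.\<close>
  have a_le_later: "a n \<le> a (n + m) + 4 / 3 * \<delta> / 4 ^ n - 4 / 3 * \<delta> / 4 ^ (n + m)" for n m
  proof (induction m)
    case (Suc m)
    have "\<delta> / 4 ^ (n + Suc m) = \<delta> / 4 ^ (n + m) / 4"
      by simp
    then show ?case
      using Suc a_step[of "n + m"] by simp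
  qed simp
  have a_bound: "a n \<le> p H + 4 / 3 * \<delta> / 4 ^ n" for n
  proof (rule field_le_epsilon)
    fix e :: real assume "0 < e"
    then obtain m where m: "(1 / 2) ^ m < e"
      using real_arch_pow_inv[of e "1 / 2"] by auto
    have "a n \<le> a (n + m) + 4 / 3 * \<delta> / 4 ^ n"
    proof -
      have "0 \<le> 4 / 3 * \<delta> / 4 ^ (n + m)"
        using \<open>0 < \<delta>\<close> by simp
      then show ?thesis
        using a_le_later[of n m] by linarith
    qed
    also have "\<dots> \<le> p H + 1 / 2 ^ (n + m) + 4 / 3 * \<delta> / 4 ^ n"
      using a_le[of "n + m"] by simp
    also have "1 / 2 ^ (n + m) \<le> (1 / 2 :: real) ^ m"
      using power_decreasing[of m "n + m" "1 / 2 :: real"] by (simp add: power_one_over)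
    finally show "a n \<le> p H + 4 / 3 * \<delta> / 4 ^ n + e"
      using m by linarith
  qed
  have pH: "\<epsilon> - 4 / 3 * \<delta> \<le> p H"
  proof -
    have "g 0 \<in> midpoint_hull (range f)"
      using g_S[of 0] by (simp add: S0)
    then obtain x where x: "x \<in> topspace X" "\<epsilon> \<le> g 0 x"
      using large by blast
    have "g 0 x \<le> p (g 0)"
      by (rule p_upper[OF x(1)]) (use g_bounds in auto)
    also have "\<dots> = a 0"
      by (simp add: a_def h_0)
    also have "\<dots> \<le> p H + 4 / 3 * \<delta>"
      using a_bound[of 0] by simp
    finally show ?thesis
      using x by simp
  qed
  \<comment> \<open>The error term solves the recursion \<open>e (n + 1) = (e n + 4 / 3 * \<delta> / 4 ^ n) / 2\<close> with
    \<open>e 0 = 0\<close>, which comes from averaging the bound on \<open>h n\<close> with \<open>a_bound\<close>.\<close>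
  have h_upper: "h n x \<le> (1 - 1 / 2 ^ n) * p H + 8 / 3 * \<delta> * (1 - 1 / 2 ^ n) / 2 ^ n"
    if x: "x \<in> topspace X" for n x
  proof (induction n)
    case 0
    then show ?case by (simp add: h_0)
  next
    case (Suc n)
    have "h n x + g n x / 2 ^ n \<le> a n"
      unfolding a_def
    proof (rule p_upper[OF x])
      fix x assume "x \<in> topspace X"
      then have "g n x \<le> 2 ^ n" "h n x \<le> 1"
        using g_bounds h_bounds by (auto intro: order_trans[OF _ one_le_power])
      moreover from this have "g n x / 2 ^ n \<le> 1"
        by (simp add: divide_le_eq)
      ultimately show "h n x + g n x / 2 ^ n \<le> 2"
        by linarith
    qed
    then have *: "h n x + g n x / 2 ^ n \<le> p H + 4 / 3 * \<delta> / 4 ^ n"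
      using a_bound[of n] by simp
    have "h (Suc n) x = (h n x + (h n x + g n x / 2 ^ n)) / 2"
      by (simp add: h_Suc field_simps)
    also have "\<dots> \<le> ((1 - 1 / 2 ^ n) * p H + 8 / 3 * \<delta> * (1 - 1 / 2 ^ n) / 2 ^ n +
        (p H + 4 / 3 * \<delta> / 4 ^ n)) / 2"
      using Suc * by simp
    also have "\<dots> = (1 - 1 / 2 ^ Suc n) * p H + 8 / 3 * \<delta> * (1 - 1 / 2 ^ Suc n) / 2 ^ Suc n"
    proof -
      define q where "q = 1 / (2 :: real) ^ n"
      have q: "1 / 2 ^ Suc n = q / 2" "1 / 4 ^ n = q * q" "c / 2 ^ n = c * q"
        "c / 2 ^ Suc n = c * q / 2" "c / 4 ^ n = c * q * q" for c :: real
        by (auto simp: q_def simp flip: power_mult_distrib)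
      show ?thesis
        unfolding q by (simp add: field_simps)
    qed
    finally show ?case .
  qed
  have "continuous_map X euclideanreal H"
    unfolding H_def
  proof (rule continuous_map_dominated_series[OF _ _ geo])
    fix k
    have "continuous_map X euclideanreal (g k)"
      using g_S[of k] cont by (auto simp: S_def intro: continuous_map_midpoint_hull)
    then show "continuous_map X euclideanreal (\<lambda>x. g k x / 2 ^ Suc k)"
      by (intro continuous_intros) auto
  qed (use g_bounds in \<open>auto simp: divide_right_mono\<close>)
  then obtain y where y: "y \<in> topspace X" "\<And>x. x \<in> topspace X \<Longrightarrow> H x \<le> H y"
    using compact_space_attains_sup[OF X ne] by blast
  have Hy: "p H \<le> H y"
    using y by (intro p_least) auto
  obtain n where n: "\<And>k. n \<le> k \<Longrightarrow> f k y \<le> \<epsilon> / 4"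
  proof -
    have "\<forall>\<^sub>F k in sequentially. f k y < \<epsilon> / 4"
      using lim[OF y(1)] \<open>0 < \<epsilon>\<close> by (intro order_tendstoD) auto
    then obtain m where "\<forall>k\<ge>m. f k y < \<epsilon> / 4"
      by (auto simp: eventually_sequentially)
    then show ?thesis
      by (intro that[of m]) (auto intro: less_imp_le)
  qed
  have "g k y \<le> \<epsilon> / 4" if "n \<le> k" for k
    by (rule midpoint_hull_le[of _ "f ` {k..}"]) (use g_S[of k] n that in \<open>auto simp: S_def\<close>)
  then have "H y - h n y \<le> \<epsilon> / 4 / 2 ^ n"
    by (rule H_le[OF y(1)])
  moreover have "(\<epsilon> - 4 * \<delta>) / 2 ^ n \<le> H y - h n y"
  proof -
    have "h n y \<le> (1 - 1 / 2 ^ n) * p H + 8 / 3 * \<delta> / 2 ^ n"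
    proof -
      have "8 / 3 * \<delta> * (1 - 1 / 2 ^ n) / 2 ^ n \<le> 8 / 3 * \<delta> * 1 / 2 ^ n"
        using \<open>0 < \<delta>\<close> by (intro divide_right_mono mult_left_mono) auto
      then show ?thesis
        using h_upper[OF y(1), of n] by simp
    qed
    then have "p H / 2 ^ n - 8 / 3 * \<delta> / 2 ^ n \<le> H y - h n y"
      using Hy by (simp add: algebra_simps)
    moreover have "(\<epsilon> - 4 / 3 * \<delta>) / 2 ^ n \<le> p H / 2 ^ n"
      using pH by (simp add: divide_right_mono)
    ultimately show ?thesis
      by (simp add: diff_divide_distrib)
  qed
  ultimately have "(\<epsilon> - 4 * \<delta>) / 2 ^ n \<le> \<epsilon> / 4 / 2 ^ n"
    by linarith
  then have "(0 :: real) < 2 ^ n \<longrightarrow> \<epsilon> - 4 * \<delta> \<le> \<epsilon> / 4"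
    unfolding divide_le_cancel by blast
  then show False
    using \<open>0 < \<epsilon>\<close> by (simp add: \<delta>_def)
qed


section \<open>Substituting parameters for variables\<close>

lemma nlists_iff: "b \<in> nlists n A \<longleftrightarrow> length b = n \<and> set b \<subseteq> A"
  by (simp add: nlists_def)

lemma eval_tm_cong: "(\<And>v. v \<in> fv_tm t \<Longrightarrow> e v = e' v) \<Longrightarrow> eval_tm S e t = eval_tm S e' t"
proof (induction t)
  case (Fn f ts)
  then have "map (eval_tm S e) ts = map (eval_tm S e') ts"
    by auto
  then show ?case
    by (simp only: eval_tm.simps)
qed simp

lemma sat_cong: "(\<And>v. v \<in> fv \<phi> \<Longrightarrow> e v = e' v) \<Longrightarrow> sat S e \<phi> = sat S e' \<phi>"
proof (induction \<phi> arbitrary: e e')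
  case (Eq s t)
  then show ?case
    using eval_tm_cong[of s e e' S] eval_tm_cong[of t e e' S] by simp
next
  case (Rel r ts)
  then have "map (eval_tm S e) ts = map (eval_tm S e') ts"
    by (auto intro!: eval_tm_cong)
  then show ?case
    by (simp only: sat.simps)
next
  case (Neg \<phi>)
  have "sat S e \<phi> = sat S e' \<phi>"
    by (rule Neg.IH) (use Neg.prems in simp)
  then show ?case
    by simp
next
  case (Disj \<phi> \<psi>)
  have "sat S e \<phi> = sat S e' \<phi>"
    by (rule Disj.IH(1)) (use Disj.prems in simp)
  moreover have "sat S e \<psi> = sat S e' \<psi>"
    by (rule Disj.IH(2)) (use Disj.prems in simp)
  ultimately show ?case
    by simp
next
  case (Ex v \<phi>)
  have "sat S (e(v := u)) \<phi> = sat S (e'(v := u)) \<phi>" for u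
    by (rule Ex.IH) (use Ex.prems in auto)
  then show ?case
    by simp
qed simp

lemma expand_simps [simp]:
  "carr (expand U) = carr U"
  "fint (expand U) (Inl f) = fint U f"
  "fint (expand U) (Inr a) as = a"
  "rint (expand U) = rint U"
  by (simp_all add: expand_def)

lemma eval_subst_tm:
  "eval_tm (expand U) e (subst_tm \<sigma> t) = eval_tm U (\<lambda>v. case_option (e v) id (\<sigma> v)) t"
proof (induction t)
  case (Fn f ts)
  then have "map (eval_tm (expand U) e) (map (subst_tm \<sigma>) ts) =
      map (eval_tm U (\<lambda>v. case_option (e v) id (\<sigma> v))) ts"
    by simp
  then show ?case
    by (simp only: subst_tm.simps eval_tm.simps expand_simps)
qed (simp split: option.split)

text \<open>No variable is captured, because only constants are substituted and a quantifier removes its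
  variable from \<open>\<sigma>\<close>.\<close>

lemma sat_subst_fm:
  "sat (expand U) e (subst_fm \<sigma> \<phi>) \<longleftrightarrow> sat U (\<lambda>v. case_option (e v) id (\<sigma> v)) \<phi>"
proof (induction \<phi> arbitrary: e \<sigma>)
  case (Rel r ts)
  then show ?case
    by (simp add: eval_subst_tm comp_def)
next
  case (Ex v \<phi>)
  have *: "(\<lambda>w. case_option ((e(v := u)) w) id ((\<sigma>(v := None)) w))
      = (\<lambda>w. case_option (e w) id (\<sigma> w))(v := u)" for u
    by (rule ext) (simp split: option.split)
  show ?case
    unfolding subst_fm.simps sat.simps expand_simps Ex.IH * ..
qed (simp_all add: eval_subst_tm)

lemma lang_params_simps [simp]:
  "Inl f \<in> funs (lang_params L A) \<longleftrightarrow> f \<in> funs L"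
  "Inr a \<in> funs (lang_params L A) \<longleftrightarrow> a \<in> A"
  "farity (lang_params L A) (Inl f) = farity L f"
  "farity (lang_params L A) (Inr a) = 0"
  "rels (lang_params L A) = rels L"
  "rarity (lang_params L A) = rarity L"
  by (auto simp: lang_params_def)

lemma fv_subst_tm: "fv_tm (subst_tm \<sigma> t) = fv_tm t - dom \<sigma>"
  by (induction t) (auto split: option.split)

lemma fv_subst_fm: "fv (subst_fm \<sigma> \<phi>) = fv \<phi> - dom \<sigma>"
  by (induction \<phi> arbitrary: \<sigma>) (auto simp: fv_subst_tm)

lemma wf_subst_tm: "wf_tm L t \<Longrightarrow> ran \<sigma> \<subseteq> A \<Longrightarrow> wf_tm (lang_params L A) (subst_tm \<sigma> t)"
  by (induction t) (auto simp: ran_def split: option.split)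

lemma wf_subst_fm: "wf_fm L \<phi> \<Longrightarrow> ran \<sigma> \<subseteq> A \<Longrightarrow> wf_fm (lang_params L A) (subst_fm \<sigma> \<phi>)"
proof (induction \<phi> arbitrary: \<sigma>)
  case (Rel r ts)
  then show ?case
    by (simp add: wf_subst_tm)
next
  case (Ex v \<phi>)
  then have "ran (\<sigma>(v := None)) \<subseteq> A"
    by (auto simp: ran_def split: if_splits)
  then show ?case
    using Ex by simp
qed (simp_all add: wf_subst_tm)

lemma ran_map_of_zip_subset: "ran (map_of (zip ys b)) \<subseteq> set b"
proof
  fix a assume "a \<in> ran (map_of (zip ys b))"
  then obtain v where "map_of (zip ys b) v = Some a"
    by (auto simp: ran_def)
  then show "a \<in> set b"
    by (rule set_zip_rightD[OF map_of_SomeD])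
qed

lemma plug_in_formulas_over:
  assumes "\<phi> \<in> formulas L (set xs \<union> set ys)" "b \<in> tuples ys A"
  shows "plug ys \<phi> b \<in> formulas_over L xs A"
proof -
  have "ran (map_of (zip ys b)) \<subseteq> A"
    using ran_map_of_zip_subset[of ys b] assms(2) by (auto simp: nlists_iff)
  then show ?thesis
    using assms wf_subst_fm[of L \<phi> "map_of (zip ys b)" A]
    by (auto simp: plug_def formulas_def fv_subst_fm nlists_iff)
qed

lemma holds_plug:
  assumes "length b = length ys"
  shows "holds U xs (plug ys \<phi> b) a \<longleftrightarrow>
    sat U (\<lambda>v. if v \<in> set ys then assign ys b v else assign xs a v) \<phi>"
proof -
  have *: "(\<lambda>v. if v \<in> set ys then assign ys b v else assign xs a v) =
    (\<lambda>v. case_option (assign xs a v) id (map_of (zip ys b) v))"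
  proof
    fix v
    show "(if v \<in> set ys then assign ys b v else assign xs a v) =
      case_option (assign xs a v) id (map_of (zip ys b) v)"
    proof (cases "v \<in> set ys")
      case True
      then obtain u where "map_of (zip ys b) v = Some u"
        using assms map_of_zip_is_Some[of ys b v] by auto
      with True show ?thesis
        by (simp add: assign_def)
    next
      case False
      then have "map_of (zip ys b) v = None"
        using assms by (simp add: map_of_zip_is_None)
      with False show ?thesis
        by simp
    qed
  qed
  show ?thesis
    unfolding holds_def plug_def sat_subst_fm * ..
qed

text \<open>The formula \<open>\<phi>(a, y)\<close> with parameters \<open>a\<close> expresses about \<open>b\<close> what \<open>\<phi>(x, b)\<close> expresses about \<open>a\<close>.
  This turns the values of \<open>Av\<close> at \<open>\<phi>(x, b)\<close> into properties of the type of \<open>b\<close>.\<close>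

lemma holds_plug_swap:
  assumes "(\<phi>, ys) \<in> partitioned L xs" "length a = length xs" "length b = length ys"
  shows "holds U xs (plug ys \<phi> b) a \<longleftrightarrow> holds U ys (plug xs \<phi> a) b"
  unfolding holds_plug[OF assms(2)] holds_plug[OF assms(3)]
  by (rule sat_cong) (use assms(1) in \<open>auto simp: partitioned_def formulas_def\<close>)

lemma assign_map: "v \<in> set ys \<Longrightarrow> assign ys (map f ys) v = f v"
  by (simp add: assign_def map_of_zip_map)

lemma holds_simps [simp]:
  "holds U xs Tru a"
  "holds U xs (Neg \<phi>) a \<longleftrightarrow> \<not> holds U xs \<phi> a"
  "holds U xs (Disj \<phi> \<psi>) a \<longleftrightarrow> holds U xs \<phi> a \<or> holds U xs \<psi> a"
  by (auto simp: holds_def)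

lemma formulas_closed [simp]:
  "Tru \<in> formulas L X"
  "Neg \<phi> \<in> formulas L X \<longleftrightarrow> \<phi> \<in> formulas L X"
  "Disj \<phi> \<psi> \<in> formulas L X \<longleftrightarrow> \<phi> \<in> formulas L X \<and> \<psi> \<in> formulas L X"
  by (auto simp: formulas_def)


section \<open>Every formula with parameters is an instance of a formula without parameters\<close>

text \<open>Bound variables are included: a parameter that is turned into a variable must not be captured.\<close>

fun vars :: "('f, 'r) fm \<Rightarrow> nat set" where
  "vars Tru = {}"
| "vars (Eq s t) = fv_tm s \<union> fv_tm t"
| "vars (Rel r ts) = (\<Union>t\<in>set ts. fv_tm t)"
| "vars (Neg \<phi>) = vars \<phi>"
| "vars (Disj \<phi> \<psi>) = vars \<phi> \<union> vars \<psi>"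
| "vars (Ex v \<phi>) = insert v (vars \<phi>)"

fun params_tm :: "('f + 'u) tm \<Rightarrow> 'u set" where
  "params_tm (Var v) = {}"
| "params_tm (Fn f ts) = (case f of Inl _ \<Rightarrow> {} | Inr a \<Rightarrow> {a}) \<union> (\<Union>t\<in>set ts. params_tm t)"

fun params :: "('f + 'u, 'r) fm \<Rightarrow> 'u set" where
  "params Tru = {}"
| "params (Eq s t) = params_tm s \<union> params_tm t"
| "params (Rel r ts) = (\<Union>t\<in>set ts. params_tm t)"
| "params (Neg \<phi>) = params \<phi>"
| "params (Disj \<phi> \<psi>) = params \<phi> \<union> params \<psi>"
| "params (Ex v \<phi>) = params \<phi>"

text \<open>The inverse of substituting parameters: each constant \<open>a\<close> becomes the variable \<open>h a\<close>.\<close>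

fun unplug_tm :: "('u \<Rightarrow> nat) \<Rightarrow> ('f + 'u) tm \<Rightarrow> 'f tm" where
  "unplug_tm h (Var v) = Var v"
| "unplug_tm h (Fn (Inl f) ts) = Fn f (map (unplug_tm h) ts)"
| "unplug_tm h (Fn (Inr a) ts) = Var (h a)"

fun unplug_fm :: "('u \<Rightarrow> nat) \<Rightarrow> ('f + 'u, 'r) fm \<Rightarrow> ('f, 'r) fm" where
  "unplug_fm h Tru = Tru"
| "unplug_fm h (Eq s t) = Eq (unplug_tm h s) (unplug_tm h t)"
| "unplug_fm h (Rel r ts) = Rel r (map (unplug_tm h) ts)"
| "unplug_fm h (Neg \<phi>) = Neg (unplug_fm h \<phi>)"
| "unplug_fm h (Disj \<phi> \<psi>) = Disj (unplug_fm h \<phi>) (unplug_fm h \<psi>)"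
| "unplug_fm h (Ex v \<phi>) = Ex v (unplug_fm h \<phi>)"

lemma finite_fv_tm: "finite (fv_tm t)"
  by (induction t) auto

lemma finite_vars: "finite (vars \<phi>)"
  by (induction \<phi>) (auto simp: finite_fv_tm)

lemma finite_params_tm: "finite (params_tm t)"
  by (induction t) (auto split: sum.split)

lemma finite_params: "finite (params \<phi>)"
  by (induction \<phi>) (auto simp: finite_params_tm)

lemma params_tm_subset: "wf_tm (lang_params L A) t \<Longrightarrow> params_tm t \<subseteq> A"
proof (induction t)
  case (Fn f ts)
  then show ?case
    by (cases f) auto
qed simp

lemma params_subset: "wf_fm (lang_params L A) \<phi> \<Longrightarrow> params \<phi> \<subseteq> A"
  by (induction \<phi>) (auto dest!: params_tm_subset)

lemma wf_unplug_tm: "wf_tm (lang_params L A) t \<Longrightarrow> wf_tm L (unplug_tm h t)"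
  by (induction h t rule: unplug_tm.induct) auto

lemma wf_unplug_fm: "wf_fm (lang_params L A) \<phi> \<Longrightarrow> wf_fm L (unplug_fm h \<phi>)"
  by (induction \<phi>) (auto intro: wf_unplug_tm)

lemma fv_unplug_tm: "fv_tm (unplug_tm h t) \<subseteq> fv_tm t \<union> h ` params_tm t"
proof (induction h t rule: unplug_tm.induct)
  case (2 h f ts)
  then have "(\<Union>t\<in>set ts. fv_tm (unplug_tm h t)) \<subseteq> (\<Union>t\<in>set ts. fv_tm t \<union> h ` params_tm t)"
    by (intro UN_mono order_refl)
  then show ?case
    by (simp add: UN_Un_distrib image_UN)
qed auto

lemma fv_unplug_fm: "fv (unplug_fm h \<phi>) \<subseteq> fv \<phi> \<union> h ` params \<phi>"
proof (induction \<phi>)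
  case (Eq s t)
  then show ?case
    using fv_unplug_tm[of h s] fv_unplug_tm[of h t] by auto
next
  case (Rel r ts)
  have "(\<Union>t\<in>set ts. fv_tm (unplug_tm h t)) \<subseteq> (\<Union>t\<in>set ts. fv_tm t \<union> h ` params_tm t)"
    by (intro UN_mono order_refl fv_unplug_tm)
  then show ?case
    by (simp add: UN_Un_distrib image_UN)
qed auto

lemma subst_unplug_tm:
  assumes "wf_tm (lang_params L A) t" "\<And>a. a \<in> params_tm t \<Longrightarrow> \<sigma> (h a) = Some a"
    "\<And>v. v \<in> fv_tm t \<Longrightarrow> \<sigma> v = None"
  shows "subst_tm \<sigma> (unplug_tm h t) = t"
  using assms
proof (induction h t rule: unplug_tm.induct)
  case (2 h f ts)
  have "subst_tm \<sigma> (unplug_tm h t) = t" if "t \<in> set ts" for t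
    by (rule "2.IH"[OF that]) (use that "2.prems" in auto)
  then show ?case
    by (auto intro!: map_idI)
qed auto

lemma subst_unplug_fm:
  assumes "wf_fm (lang_params L A) \<phi>" "\<And>a. a \<in> params \<phi> \<Longrightarrow> \<sigma> (h a) = Some a"
    "\<And>v. v \<in> vars \<phi> \<Longrightarrow> \<sigma> v = None"
  shows "subst_fm \<sigma> (unplug_fm h \<phi>) = \<phi>"
  using assms
proof (induction \<phi>)
  case (Eq s t)
  then show ?case
    using subst_unplug_tm[of L A s \<sigma> h] subst_unplug_tm[of L A t \<sigma> h] by simp
next
  case (Rel r ts)
  have "subst_tm \<sigma> (unplug_tm h t) = t" if "t \<in> set ts" for t
    by (rule subst_unplug_tm) (use that Rel in auto)
  then show ?case
    by (auto intro!: map_idI)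
next
  case (Neg \<phi>)
  have "subst_fm \<sigma> (unplug_fm h \<phi>) = \<phi>"
    by (rule Neg.IH) (use Neg.prems in auto)
  then show ?case
    by simp
next
  case (Disj \<phi> \<psi>)
  have "subst_fm \<sigma> (unplug_fm h \<phi>) = \<phi>"
    by (rule Disj.IH(1)) (use Disj.prems in auto)
  moreover have "subst_fm \<sigma> (unplug_fm h \<psi>) = \<psi>"
    by (rule Disj.IH(2)) (use Disj.prems in auto)
  ultimately show ?case
    by simp
next
  case (Ex v \<phi>)
  have "\<sigma>(v := None) = \<sigma>"
    using Ex.prems(3)[of v] by auto
  moreover have "subst_fm \<sigma> (unplug_fm h \<phi>) = \<phi>"
    by (rule Ex.IH) (use Ex.prems in auto)
  ultimately show ?case
    by simp
qed simp

text \<open>Replace the parameters of \<open>\<psi>\<close> by distinct variables that are larger than all variables of \<open>\<psi>\<close> and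
  \<open>xs\<close>.\<close>

lemma ex_plug:
  assumes "\<psi> \<in> formulas_over L xs A"
  obtains \<phi> ys b where "(\<phi>, ys) \<in> partitioned L xs" "b \<in> tuples ys A" "plug ys \<phi> b = \<psi>"
proof -
  obtain b where b: "set b = params \<psi>" "distinct b"
    using finite_distinct_list[OF finite_params[of \<psi>]] by blast
  obtain N where N: "v < N" if "v \<in> vars \<psi> \<union> set xs" for v
    using finite_nat_set_iff_bounded[of "vars \<psi> \<union> set xs"] finite_vars[of \<psi>] by auto
  obtain i :: "'b \<Rightarrow> nat" where i: "inj_on i (params \<psi>)"
    using finite_imp_inj_to_nat_seg[OF finite_params[of \<psi>]] by blast
  define h where "h a = N + i a" for a
  define \<phi> where "\<phi> = unplug_fm h \<psi>"
  define ys where "ys = map h b"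
  have h_inj: "inj_on h (set b)"
    using i b by (auto simp: h_def inj_on_def)
  have wf: "wf_fm (lang_params L A) \<psi>" "fv \<psi> \<subseteq> set xs"
    using assms by (auto simp: formulas_def)
  have "distinct ys" "set xs \<inter> set ys = {}"
    using h_inj b N by (force simp: ys_def distinct_map h_def)+
  moreover have "wf_fm L \<phi>" "fv \<phi> \<subseteq> set xs \<union> set ys"
    using wf_unplug_fm[OF wf(1)] fv_unplug_fm[of h \<psi>] wf(2) b by (auto simp: \<phi>_def ys_def)
  ultimately have "(\<phi>, ys) \<in> partitioned L xs"
    by (simp add: partitioned_def formulas_def)
  moreover have "b \<in> tuples ys A"
    using params_subset[OF wf(1)] b by (simp add: nlists_iff ys_def)
  moreover have "plug ys \<phi> b = \<psi>"
    unfolding plug_def \<phi>_def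
  proof (rule subst_unplug_fm[OF wf(1)])
    fix a assume "a \<in> params \<psi>"
    then have "(h a, a) \<in> set (zip ys b)"
      using b by (auto simp: ys_def zip_map1 zip_same_conv_map)
    then show "map_of (zip ys b) (h a) = Some a"
      using \<open>distinct ys\<close> by (intro map_of_is_SomeI) (auto simp: ys_def)
  next
    fix v assume "v \<in> vars \<psi>"
    then have "v \<notin> set ys"
      using N by (force simp: ys_def h_def)
    then show "map_of (zip ys b) v = None"
      using b by (auto simp: map_of_eq_None_iff dest: set_zip_leftD)
  qed
  ultimately show ?thesis
    using that by blast
qed


section \<open>Countably many formulas\<close>

instance tm :: (countable) countable
  by countable_datatype

instance fm :: (countable, countable) countable
  by countable_datatype

lemma wf_tm_set: "wf_tm L t \<Longrightarrow> set_tm t \<subseteq> funs L"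
proof (induction t)
  case (Fn f ts)
  have "set_tm t \<subseteq> funs L" if "t \<in> set ts" for t
    by (rule Fn.IH) (use Fn.prems that in auto)
  then have "(\<Union>t\<in>set ts. set_tm t) \<subseteq> funs L"
    by (rule UN_least)
  then show ?case
    using Fn.prems by simp
qed simp

lemma wf_fm_sets: "wf_fm L \<phi> \<Longrightarrow> set1_fm \<phi> \<subseteq> funs L \<and> set2_fm \<phi> \<subseteq> rels L"
proof (induction \<phi>)
  case (Rel r ts)
  then have "(\<Union>t\<in>set ts. set_tm t) \<subseteq> funs L"
    by (intro UN_least wf_tm_set) simp
  then show ?case
    using Rel by simp
qed (simp_all add: wf_tm_set)

text \<open>Coding the symbols of the language by natural numbers embeds its formulas into the formulas over
  a countable type of symbols.\<close>

lemma countable_formulas: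
  fixes L :: "('f, 'r) lang"
  assumes "countable (funs L)" "countable (rels L)"
  shows "countable (formulas L X)"
proof -
  obtain f :: "'f \<Rightarrow> nat" where f: "inj_on f (funs L)"
    using assms(1) unfolding countable_def by blast
  obtain r :: "'r \<Rightarrow> nat" where r: "inj_on r (rels L)"
    using assms(2) unfolding countable_def by blast
  let ?c = "map_fm f r" and ?d = "map_fm (inv_into (funs L) f) (inv_into (rels L) r)"
  have "?d (?c \<phi>) = \<phi>" if "\<phi> \<in> formulas L X" for \<phi>
  proof -
    have "set1_fm \<phi> \<subseteq> funs L" "set2_fm \<phi> \<subseteq> rels L"
      using wf_fm_sets that by (auto simp: formulas_def)
    then have "map_fm (inv_into (funs L) f \<circ> f) (inv_into (rels L) r \<circ> r) \<phi> = map_fm id id \<phi>"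
      using f r by (intro fm.map_cong refl) (simp_all add: subset_iff)
    then show ?thesis
      by (simp add: fm.map_comp fm.map_id)
  qed
  then have "formulas L X \<subseteq> range ?d"
    by (auto intro: range_eqI[OF sym])
  then show ?thesis
    by (rule countable_subset) (rule countable_image, rule countableI_type)
qed

lemma countable_partitioned:
  assumes "countable (funs L)" "countable (rels L)"
  shows "countable (partitioned L xs)"
proof (rule countable_subset)
  show "partitioned L xs \<subseteq> formulas L UNIV \<times> UNIV"
    by (auto simp: partitioned_def formulas_def)
  show "countable (formulas L UNIV \<times> (UNIV :: nat list set))"
    using countable_formulas[OF assms] by (rule countable_SIGMA) (rule countableI_type)
qed


section \<open>Compactness of the type space\<close>

lemma tp_eq_iff:
  "tp L U ys A b = tp L U ys A b' \<longleftrightarrow>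
    (\<forall>\<psi>\<in>formulas_over L ys A. holds U ys \<psi> b \<longleftrightarrow> holds U ys \<psi> b')"
  by (auto simp: tp_def)

lemma realizes_finite_subtype:
  assumes "q \<in> types L U ys A" "finite q0" "q0 \<subseteq> q"
  obtains b where "realizes U ys b q0"
  using assms that unfolding types_def by blast

text \<open>Types are complete by definition, and consistent because their finite subsets are realized.\<close>

lemma Neg_in_type_iff:
  assumes q: "q \<in> types L U ys A" and "\<psi> \<in> formulas_over L ys A"
  shows "Neg \<psi> \<in> q \<longleftrightarrow> \<psi> \<notin> q"
proof -
  have "\<not> (\<psi> \<in> q \<and> Neg \<psi> \<in> q)"
    using realizes_finite_subtype[OF q, of "{\<psi>, Neg \<psi>}"] by (auto simp: realizes_def)
  then show ?thesis
    using assms by (auto simp: types_def)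
qed

lemma Conj_in_type_iff:
  assumes q: "q \<in> types L U ys A"
    and \<phi>: "\<phi> \<in> formulas_over L ys A" and \<psi>: "\<psi> \<in> formulas_over L ys A"
  shows "Conj \<phi> \<psi> \<in> q \<longleftrightarrow> \<phi> \<in> q \<and> \<psi> \<in> q"
proof -
  have Neg: "Neg \<theta> \<in> q \<longleftrightarrow> \<theta> \<notin> q" if "\<theta> \<in> {\<phi>, \<psi>, Disj (Neg \<phi>) (Neg \<psi>)}" for \<theta>
    by (rule Neg_in_type_iff[OF q]) (use that \<phi> \<psi> in auto)
  have "\<not> {Conj \<phi> \<psi>, Neg \<phi>} \<subseteq> q" "\<not> {Conj \<phi> \<psi>, Neg \<psi>} \<subseteq> q"
    "\<not> {\<phi>, \<psi>, Disj (Neg \<phi>) (Neg \<psi>)} \<subseteq> q"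
    using realizes_finite_subtype[OF q, of "{Conj \<phi> \<psi>, Neg \<phi>}"]
      realizes_finite_subtype[OF q, of "{Conj \<phi> \<psi>, Neg \<psi>}"]
      realizes_finite_subtype[OF q, of "{\<phi>, \<psi>, Disj (Neg \<phi>) (Neg \<psi>)}"]
    by (auto simp: realizes_def)
  then show ?thesis
    using Neg[of \<phi>] Neg[of \<psi>] Neg[of "Disj (Neg \<phi>) (Neg \<psi>)"] by blast
qed

lemma tp_in_types: "b \<in> tuples ys (carr U) \<Longrightarrow> tp L U ys A b \<in> types L U ys A"
  by (auto simp: tp_def types_def realizes_def)

lemma tp_realization:
  assumes q: "q \<in> types L U ys A" and b: "realizes U ys b q"
  shows "tp L U ys A b = q"
proof -
  have "\<psi> \<in> q" if "\<psi> \<in> formulas_over L ys A" "holds U ys \<psi> b" for \<psi>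
    using Neg_in_type_iff[OF q that(1)] b that(2) by (auto simp: realizes_def)
  moreover have "q \<subseteq> formulas_over L ys A"
    using q by (simp add: types_def)
  ultimately show ?thesis
    using b by (auto simp: tp_def realizes_def)
qed

text \<open>Lindenbaum's lemma: a maximal finitely satisfiable set is complete.  Otherwise both \<open>\<psi>\<close> and its
  negation contradict finite parts of it, while a tuple that realizes both of these parts
  satisfies one of \<open>\<psi>\<close> and its negation.\<close>

lemma ex_complete_type:
  assumes p: "p \<subseteq> formulas_over L ys A"
    and fin: "\<And>p0. finite p0 \<Longrightarrow> p0 \<subseteq> p \<Longrightarrow> \<exists>b. realizes U ys b p0"
  shows "\<exists>q\<in>types L U ys A. p \<subseteq> q"
proof -
  define fs where "fs q \<longleftrightarrow> (\<forall>q0. finite q0 \<and> q0 \<subseteq> q \<longrightarrow> (\<exists>b. realizes U ys b q0))" for q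
  define \<Q> where "\<Q> = {q. p \<subseteq> q \<and> q \<subseteq> formulas_over L ys A \<and> fs q}"
  have "\<exists>q\<in>\<Q>. \<forall>q'\<in>\<Q>. q \<subseteq> q' \<longrightarrow> q' = q"
  proof (rule subset_Zorn_nonempty)
    show "\<Q> \<noteq> {}"
      using p fin by (auto simp: \<Q>_def fs_def)
    fix \<C> assume ne: "\<C> \<noteq> {}" and chain: "subset.chain \<Q> \<C>"
    then have "\<C> \<subseteq> \<Q>"
      by (simp add: subset_chain_def)
    have "fs (\<Union>\<C>)"
      unfolding fs_def
    proof (intro allI impI)
      fix q0 assume q0: "finite q0 \<and> q0 \<subseteq> \<Union>\<C>"
      have "\<exists>q\<in>\<C>. q0 \<subseteq> q"
        using finite_subset_Union_chain[of q0 \<C>] q0 ne chain by (metis subset_chain_def)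
      then show "\<exists>b. realizes U ys b q0"
        using q0 \<open>\<C> \<subseteq> \<Q>\<close> by (auto simp: \<Q>_def fs_def)
    qed
    then show "\<Union>\<C> \<in> \<Q>"
      using ne \<open>\<C> \<subseteq> \<Q>\<close> unfolding \<Q>_def by auto
  qed
  then obtain q where q: "q \<in> \<Q>" and max: "\<And>q'. q' \<in> \<Q> \<Longrightarrow> q \<subseteq> q' \<Longrightarrow> q' = q"
    by blast
  have refuted: "\<exists>q0. finite q0 \<and> q0 \<subseteq> q \<and> (\<forall>b. realizes U ys b q0 \<longrightarrow> \<not> holds U ys \<theta> b)"
    if "\<theta> \<notin> q" "\<theta> \<in> formulas_over L ys A" for \<theta>
  proof -
    have "insert \<theta> q \<notin> \<Q>"
      using max[of "insert \<theta> q"] that(1) by auto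
    then have "\<not> fs (insert \<theta> q)"
      using q that(2) by (auto simp: \<Q>_def)
    then obtain q1 where q1: "finite q1" "q1 \<subseteq> insert \<theta> q" "\<And>b. \<not> realizes U ys b q1"
      unfolding fs_def by blast
    then have "finite (q1 - {\<theta>}) \<and> q1 - {\<theta>} \<subseteq> q \<and>
        (\<forall>b. realizes U ys b (q1 - {\<theta>}) \<longrightarrow> \<not> holds U ys \<theta> b)"
      by (auto simp: realizes_def)
    then show ?thesis
      by blast
  qed
  have "\<psi> \<in> q \<or> Neg \<psi> \<in> q" if \<psi>: "\<psi> \<in> formulas_over L ys A" for \<psi>
  proof (rule ccontr)
    assume *: "\<not> ?thesis"
    then obtain q1 where q1: "finite q1" "q1 \<subseteq> q" "\<And>b. realizes U ys b q1 \<Longrightarrow> \<not> holds U ys \<psi> b"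
      using refuted[of \<psi>] \<psi> by blast
    from * obtain q2 where q2: "finite q2" "q2 \<subseteq> q" "\<And>b. realizes U ys b q2 \<Longrightarrow> holds U ys \<psi> b"
      using refuted[of "Neg \<psi>"] \<psi> by auto
    have "fs q" "finite (q1 \<union> q2) \<and> q1 \<union> q2 \<subseteq> q"
      using q q1(1,2) q2(1,2) by (auto simp: \<Q>_def)
    then obtain b where "realizes U ys b (q1 \<union> q2)"
      unfolding fs_def by blast
    then have "realizes U ys b q1" "realizes U ys b q2"
      by (auto simp: realizes_def)
    then show False
      using q1(3) q2(3) by blast
  qed
  then have "q \<in> types L U ys A"
    using q unfolding \<Q>_def fs_def types_def by blast
  then show ?thesis
    using q by (auto simp: \<Q>_def)
qed

lemma openin_type_space_basic:
  "\<psi> \<in> formulas_over L ys A \<Longrightarrow> openin (type_space L U ys A) {q \<in> types L U ys A. \<psi> \<in> q}"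
  unfolding type_space_def by (rule topology_generated_by_Basis) simp

lemma Tru_in_type: "q \<in> types L U ys A \<Longrightarrow> Tru \<in> q"
  using Neg_in_type_iff[of q L U ys A Tru] realizes_finite_subtype[of q L U ys A "{Fls}"]
  by (auto simp: realizes_def)

lemma topspace_type_space [simp]: "topspace (type_space L U ys A) = types L U ys A"
  using Tru_in_type unfolding type_space_def topology_generated_by_topspace
  by (auto intro!: bexI[of _ Tru])

text \<open>Since types are closed under conjunction, the given subbasis is a basis.\<close>

lemma openin_type_space_nbhd:
  assumes "openin (type_space L U ys A) W" "q \<in> W"
  obtains \<psi> where "\<psi> \<in> formulas_over L ys A" "\<psi> \<in> q" "{r \<in> types L U ys A. \<psi> \<in> r} \<subseteq> W"
proof -
  let ?nbhd = "\<lambda>W. \<forall>q\<in>W. q \<in> types L U ys A \<and>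
    (\<exists>\<psi>\<in>formulas_over L ys A. \<psi> \<in> q \<and> {r \<in> types L U ys A. \<psi> \<in> r} \<subseteq> W)"
  have "generate_topology_on ((\<lambda>\<phi>. {q \<in> types L U ys A. \<phi> \<in> q}) ` formulas_over L ys A) W"
    using assms(1) unfolding type_space_def openin_topology_generated_by_iff .
  then have "?nbhd W"
  proof (induction rule: generate_topology_on.induct)
    case (Int V W)
    show ?case
    proof
      fix q assume q: "q \<in> V \<inter> W"
      then have q_type: "q \<in> types L U ys A"
        using Int.IH by blast
      obtain \<phi> where \<phi>: "\<phi> \<in> formulas_over L ys A" "\<phi> \<in> q" "{r \<in> types L U ys A. \<phi> \<in> r} \<subseteq> V"
        using Int.IH(1) q by blast
      obtain \<psi> where \<psi>: "\<psi> \<in> formulas_over L ys A" "\<psi> \<in> q" "{r \<in> types L U ys A. \<psi> \<in> r} \<subseteq> W"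
        using Int.IH(2) q by blast
      have "Conj \<phi> \<psi> \<in> q"
        using Conj_in_type_iff[OF q_type \<phi>(1) \<psi>(1)] \<phi>(2) \<psi>(2) by blast
      moreover have "{r \<in> types L U ys A. Conj \<phi> \<psi> \<in> r} \<subseteq> V \<inter> W"
        using Conj_in_type_iff[OF _ \<phi>(1) \<psi>(1)] \<phi>(3) \<psi>(3) by blast
      moreover have "Conj \<phi> \<psi> \<in> formulas_over L ys A"
        using \<phi>(1) \<psi>(1) by simp
      ultimately show "q \<in> types L U ys A \<and>
          (\<exists>\<psi>\<in>formulas_over L ys A. \<psi> \<in> q \<and> {r \<in> types L U ys A. \<psi> \<in> r} \<subseteq> V \<inter> W)"
        using q_type by blast
    qed
  next
    case (UN K)
    then show ?case
      by (meson Sup_upper UnionE order_trans)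
  qed auto
  then show ?thesis
    using assms(2) that by blast
qed

text \<open>Consider the formulas whose basic open set lies in a member of a given cover.  If their negations
  were finitely satisfiable, a complete type containing them all would lie outside the cover.  So
  finitely many of the negations are inconsistent, and the corresponding members form a subcover.\<close>

lemma compact_type_space: "compact_space (type_space L U ys A)"
  unfolding compact_space_alt
proof (intro allI impI)
  fix \<W> assume "(\<forall>W\<in>\<W>. openin (type_space L U ys A) W) \<and>
    topspace (type_space L U ys A) \<subseteq> \<Union>\<W>"
  then have op: "\<forall>W\<in>\<W>. openin (type_space L U ys A) W"
    and cover: "topspace (type_space L U ys A) \<subseteq> \<Union>\<W>"
    by blast+
  define \<Phi> where
    "\<Phi> = {\<psi> \<in> formulas_over L ys A. \<exists>W\<in>\<W>. {q \<in> types L U ys A. \<psi> \<in> q} \<subseteq> W}"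
  have "\<not> (\<exists>q\<in>types L U ys A. Neg ` \<Phi> \<subseteq> q)"
  proof
    assume "\<exists>q\<in>types L U ys A. Neg ` \<Phi> \<subseteq> q"
    then obtain q where q: "q \<in> types L U ys A" "Neg ` \<Phi> \<subseteq> q"
      by blast
    then obtain W where W: "W \<in> \<W>" "q \<in> W"
      using cover by auto
    have "openin (type_space L U ys A) W"
      using op W(1) by blast
    from openin_type_space_nbhd[OF this W(2)]
    obtain \<psi> where "\<psi> \<in> formulas_over L ys A" "\<psi> \<in> q" "{r \<in> types L U ys A. \<psi> \<in> r} \<subseteq> W" .
    then show False
      using q W Neg_in_type_iff[OF q(1)] by (auto simp: \<Phi>_def)
  qed
  moreover have "Neg ` \<Phi> \<subseteq> formulas_over L ys A"
    by (auto simp: \<Phi>_def)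
  ultimately obtain p0 where "finite p0" "p0 \<subseteq> Neg ` \<Phi>" and p0: "\<And>b. \<not> realizes U ys b p0"
    using ex_complete_type[where p = "Neg ` \<Phi>" and L = L and ys = ys and A = A and U = U] by blast
  then obtain \<Phi>0 where \<Phi>0: "finite \<Phi>0" "\<Phi>0 \<subseteq> \<Phi>" "p0 = Neg ` \<Phi>0"
    using finite_subset_image[OF \<open>finite p0\<close> \<open>p0 \<subseteq> Neg ` \<Phi>\<close>] by blast
  have "\<forall>\<psi>\<in>\<Phi>0. \<exists>W\<in>\<W>. {q \<in> types L U ys A. \<psi> \<in> q} \<subseteq> W"
    using \<Phi>0 by (auto simp: \<Phi>_def)
  then obtain W where W: "\<forall>\<psi>\<in>\<Phi>0. W \<psi> \<in> \<W> \<and> {q \<in> types L U ys A. \<psi> \<in> q} \<subseteq> W \<psi>"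
    unfolding Bex_def by (rule bchoice[THEN exE])
  have "\<exists>\<psi>\<in>\<Phi>0. \<psi> \<in> q" if q: "q \<in> types L U ys A" for q
  proof (rule ccontr)
    assume "\<not> ?thesis"
    then have "p0 \<subseteq> q"
      using \<Phi>0 Neg_in_type_iff[OF q] by (auto simp: \<Phi>_def)
    then show False
      using realizes_finite_subtype[OF q \<open>finite p0\<close>] p0 by blast
  qed
  then have "topspace (type_space L U ys A) \<subseteq> \<Union>(W ` \<Phi>0)"
    using W by (simp add: subset_iff) blast
  then show "\<exists>\<F>. finite \<F> \<and> \<F> \<subseteq> \<W> \<and> topspace (type_space L U ys A) \<subseteq> \<Union>\<F>"
    using \<Phi>0(1) W by (intro exI[of _ "W ` \<Phi>0"]) auto
qed


section \<open>Keisler measures and averages of points\<close>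

lemma partitionedD:
  assumes "(\<phi>, ys) \<in> partitioned L xs"
  shows "\<phi> \<in> formulas L (set xs \<union> set ys)" "\<phi> \<in> formulas L (set ys \<union> set xs)" "distinct ys"
  using assms by (auto simp: partitioned_def Un_commute)

lemma keisler_eq_if_equivalent:
  assumes "\<mu> \<in> keisler L U xs" "\<phi> \<in> formulas_over L xs (carr U)" "\<psi> \<in> formulas_over L xs (carr U)"
    "\<And>a. a \<in> tuples xs (carr U) \<Longrightarrow> holds U xs \<phi> a \<longleftrightarrow> holds U xs \<psi> a"
  shows "\<mu> \<phi> = \<mu> \<psi>"
  using assms unfolding keisler_def by blast

lemma keisler_Neg:
  assumes \<mu>: "\<mu> \<in> keisler L U xs" and \<psi>: "\<psi> \<in> formulas_over L xs (carr U)"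
  shows "\<mu> (Neg \<psi>) = 1 - \<mu> \<psi>"
proof -
  have "\<mu> (Disj \<psi> (Neg \<psi>)) = \<mu> \<psi> + \<mu> (Neg \<psi>)"
  proof -
    have "\<forall>a\<in>tuples xs (carr U). \<not> holds U xs (Conj \<psi> (Neg \<psi>)) a"
      by simp
    moreover have "Neg \<psi> \<in> formulas_over L xs (carr U)"
      using \<psi> by simp
    ultimately show ?thesis
      using \<mu> \<psi> unfolding keisler_def by blast
  qed
  moreover have "\<mu> (Disj \<psi> (Neg \<psi>)) = \<mu> Tru"
    by (rule keisler_eq_if_equivalent[OF \<mu>]) (use \<psi> in auto)
  moreover have "\<mu> Tru = 1"
    using \<mu> by (simp add: keisler_def)
  ultimately show ?thesis
    by simp
qed

lemma keisler_bounds: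
  assumes "\<mu> \<in> keisler L U xs" "\<psi> \<in> formulas_over L xs (carr U)"
  shows "0 \<le> \<mu> \<psi>" "\<mu> \<psi> \<le> 1"
proof -
  have nonneg: "0 \<le> \<mu> \<theta>" if "\<theta> \<in> formulas_over L xs (carr U)" for \<theta>
    using assms(1) that unfolding keisler_def by blast
  show "0 \<le> \<mu> \<psi>"
    using nonneg assms(2) .
  show "\<mu> \<psi> \<le> 1"
    using nonneg[of "Neg \<psi>"] keisler_Neg[OF assms] assms(2) by simp
qed

lemma Av_eq:
  assumes "\<psi> \<in> formulas_over L xs (carr U)"
  shows "Av L U xs as \<psi> = real (length (filter (holds U xs \<psi>) as)) / real (length as)"
  using assms by (simp add: Av_def length_filter_conv_card)

lemma length_filter_disjoint:
  assumes "\<And>x. x \<in> set zs \<Longrightarrow> \<not> (P x \<and> Q x)"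
  shows "length (filter (\<lambda>x. P x \<or> Q x) zs) = length (filter P zs) + length (filter Q zs)"
  using assms by (induction zs) auto

lemma Av_in_keisler:
  assumes as: "as \<in> point_seqs xs A" and A: "A \<subseteq> carr U"
  shows "Av L U xs as \<in> keisler L U xs"
proof -
  let ?F = "formulas_over L xs (carr U)"
  have sub: "set as \<subseteq> tuples xs (carr U)" and "as \<noteq> []"
    using as nlists_mono[OF A] by (auto simp: point_seqs_def)
  have "Av L U xs as \<phi> = Av L U xs as \<psi>"
    if "\<phi> \<in> ?F" "\<psi> \<in> ?F" "\<forall>a\<in>tuples xs (carr U). holds U xs \<phi> a \<longleftrightarrow> holds U xs \<psi> a" for \<phi> \<psi>
  proof -
    have "filter (holds U xs \<phi>) as = filter (holds U xs \<psi>) as"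
      using sub that(3) by (intro filter_cong) auto
    then show ?thesis
      using that by (simp add: Av_eq)
  qed
  moreover have "Av L U xs as (Disj \<phi> \<psi>) = Av L U xs as \<phi> + Av L U xs as \<psi>"
    if "\<phi> \<in> ?F" "\<psi> \<in> ?F" "\<forall>a\<in>tuples xs (carr U). \<not> holds U xs (Conj \<phi> \<psi>) a" for \<phi> \<psi>
  proof -
    have "length (filter (holds U xs (Disj \<phi> \<psi>)) as)
        = length (filter (\<lambda>a. holds U xs \<phi> a \<or> holds U xs \<psi> a) as)"
      by (intro arg_cong[where f = length] filter_cong) auto
    also have "\<dots> = length (filter (holds U xs \<phi>) as) + length (filter (holds U xs \<psi>) as)"
      using sub that(3) by (intro length_filter_disjoint) auto
    finally show ?thesis
      using that by (simp add: Av_eq add_divide_distrib)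
  qed
  moreover have "0 \<le> Av L U xs as \<psi>" if "\<psi> \<in> ?F" for \<psi>
    using that by (simp add: Av_eq)
  moreover have "Av L U xs as Tru = 1"
    using \<open>as \<noteq> []\<close> by (simp add: Av_eq)
  moreover have "Av L U xs as \<in> extensional ?F"
    by (simp add: Av_def)
  ultimately show ?thesis
    unfolding keisler_def by blast
qed

text \<open>Repeat each of the two sequences as often as the other one is long and concatenate: both parts
  then have the same length.\<close>

lemma ex_Av_midpoint:
  assumes "as \<in> point_seqs xs A" "as' \<in> point_seqs xs A"
  shows "\<exists>cs\<in>point_seqs xs A. \<forall>\<psi>\<in>formulas_over L xs (carr U).
    Av L U xs cs \<psi> = (Av L U xs as \<psi> + Av L U xs as' \<psi>) / 2"
proof
  let ?cs = "concat (replicate (length as') as) @ concat (replicate (length as) as')"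
  have "as \<noteq> []" "as' \<noteq> []"
    using assms by (auto simp: point_seqs_def)
  then show "?cs \<in> point_seqs xs A"
    using assms by (auto simp: point_seqs_def)
  have "real (length as) \<noteq> 0" "real (length as') \<noteq> 0"
    using \<open>as \<noteq> []\<close> \<open>as' \<noteq> []\<close> by auto
  then show "\<forall>\<psi>\<in>formulas_over L xs (carr U).
      Av L U xs ?cs \<psi> = (Av L U xs as \<psi> + Av L U xs as' \<psi>) / 2"
    by (simp add: Av_eq filter_concat length_concat sum_list_replicate) (simp add: field_simps)
qed

lemma Av_plug_cong:
  assumes as: "as \<in> point_seqs xs A"
    and \<phi>: "(\<phi>, ys) \<in> partitioned L xs"
    and b: "b \<in> tuples ys (carr U)" and b': "b' \<in> tuples ys (carr U)"
    and eq: "\<And>a. a \<in> set as \<Longrightarrow> holds U ys (plug xs \<phi> a) b \<longleftrightarrow> holds U ys (plug xs \<phi> a) b'"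
  shows "Av L U xs as (plug ys \<phi> b) = Av L U xs as (plug ys \<phi> b')"
proof -
  have "holds U xs (plug ys \<phi> b) a \<longleftrightarrow> holds U xs (plug ys \<phi> b') a" if "a \<in> set as" for a
  proof -
    have "length a = length xs"
      using as that by (auto simp: point_seqs_def nlists_iff)
    then show ?thesis
      using eq[OF that] holds_plug_swap[OF \<phi>, of a b U] holds_plug_swap[OF \<phi>, of a b' U] b b'
      by (simp add: nlists_iff)
  qed
  then have "filter (holds U xs (plug ys \<phi> b)) as = filter (holds U xs (plug ys \<phi> b')) as"
    by (intro filter_cong) auto
  moreover have "plug ys \<phi> b \<in> formulas_over L xs (carr U)"
    "plug ys \<phi> b' \<in> formulas_over L xs (carr U)"
    by (rule plug_in_formulas_over[OF partitionedD(1)[OF \<phi>]], fact)+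
  ultimately show ?thesis
    by (simp add: Av_eq)
qed

lemma Av_plug_tp_cong:
  assumes as: "as \<in> point_seqs xs A"
    and \<phi>: "(\<phi>, ys) \<in> partitioned L xs"
    and b: "b \<in> tuples ys (carr U)" and b': "b' \<in> tuples ys (carr U)"
    and tp: "tp L U ys A b = tp L U ys A b'"
  shows "Av L U xs as (plug ys \<phi> b) = Av L U xs as (plug ys \<phi> b')"
proof (rule Av_plug_cong[OF as \<phi> b b'])
  fix a assume "a \<in> set as"
  then have "plug xs \<phi> a \<in> formulas_over L ys A"
    using as by (intro plug_in_formulas_over[OF partitionedD(2)[OF \<phi>]]) (auto simp: point_seqs_def)
  then show "holds U ys (plug xs \<phi> a) b \<longleftrightarrow> holds U ys (plug xs \<phi> a) b'"
    using tp by (auto simp: tp_eq_iff)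
qed

text \<open>The supremum in the definition is over a nonempty set that is bounded, because all values lie in
  \<open>[0, 1]\<close>; without this, a supremum of reals would carry no information.\<close>

lemma finitely_approximated_iff:
  assumes \<mu>: "\<mu> \<in> keisler L U xs" and U: "carr U \<noteq> {}" and A: "A \<subseteq> carr U"
  shows "finitely_approximated L U xs A \<mu> \<longleftrightarrow>
    (\<forall>(\<phi>, ys)\<in>partitioned L xs. \<forall>\<epsilon>>0. \<exists>as\<in>point_seqs xs A. \<forall>b\<in>tuples ys (carr U).
      \<bar>\<mu> (plug ys \<phi> b) - Av L U xs as (plug ys \<phi> b)\<bar> < \<epsilon>)"
    (is "_ \<longleftrightarrow> (\<forall>(\<phi>, ys)\<in>_. \<forall>\<epsilon>>0. \<exists>as\<in>_. \<forall>b\<in>_. ?d \<phi> ys as b < \<epsilon>)")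
proof -
  have ne: "tuples ys (carr U) \<noteq> {}" for ys
    using nlists_not_empty[OF U] by blast
  have bdd: "bdd_above (?d \<phi> ys as ` tuples ys (carr U))"
    if \<phi>: "(\<phi>, ys) \<in> partitioned L xs" and as: "as \<in> point_seqs xs A" for \<phi> ys as
  proof (rule bdd_aboveI2)
    fix b assume "b \<in> tuples ys (carr U)"
    then have "plug ys \<phi> b \<in> formulas_over L xs (carr U)"
      by (rule plug_in_formulas_over[OF partitionedD(1)[OF \<phi>]])
    then show "?d \<phi> ys as b \<le> 1"
      using keisler_bounds[OF \<mu>] keisler_bounds[OF Av_in_keisler[OF as A]] by (smt (verit))
  qed
  have eq: "(\<forall>\<epsilon>>0. \<exists>as\<in>point_seqs xs A. (SUP b\<in>tuples ys (carr U). ?d \<phi> ys as b) < \<epsilon>) \<longleftrightarrow>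
      (\<forall>\<epsilon>>0. \<exists>as\<in>point_seqs xs A. \<forall>b\<in>tuples ys (carr U). ?d \<phi> ys as b < \<epsilon>)" (is "?l \<longleftrightarrow> ?r")
    if \<phi>: "(\<phi>, ys) \<in> partitioned L xs" for \<phi> ys
  proof
    assume l: ?l
    show ?r
    proof (intro allI impI)
      fix \<epsilon> :: real assume "0 < \<epsilon>"
      then obtain as where as: "as \<in> point_seqs xs A" "(SUP b\<in>tuples ys (carr U). ?d \<phi> ys as b) < \<epsilon>"
        using l by blast
      then have "?d \<phi> ys as b < \<epsilon>" if "b \<in> tuples ys (carr U)" for b
        using cSUP_upper[OF that bdd[OF \<phi> as(1)]] by simp
      then show "\<exists>as\<in>point_seqs xs A. \<forall>b\<in>tuples ys (carr U). ?d \<phi> ys as b < \<epsilon>"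
        using as(1) by blast
    qed
  next
    assume r: ?r
    show ?l
    proof (intro allI impI)
      fix \<epsilon> :: real assume "0 < \<epsilon>"
      then obtain as where as: "as \<in> point_seqs xs A" "\<forall>b\<in>tuples ys (carr U). ?d \<phi> ys as b < \<epsilon> / 2"
        using r half_gt_zero by blast
      have "(SUP b\<in>tuples ys (carr U). ?d \<phi> ys as b) \<le> \<epsilon> / 2"
        using as(2) by (intro cSUP_least[OF ne]) (simp add: less_imp_le)
      also have "\<dots> < \<epsilon>"
        using \<open>0 < \<epsilon>\<close> by simp
      finally show "\<exists>as\<in>point_seqs xs A. (SUP b\<in>tuples ys (carr U). ?d \<phi> ys as b) < \<epsilon>"
        using as(1) by blast
    qed
  qed
  show ?thesis
    unfolding finitely_approximated_def
  proof (rule ball_cong[OF refl])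
    fix p assume "p \<in> partitioned L xs"
    then show "(case p of (\<phi>, ys) \<Rightarrow>
          \<forall>\<epsilon>>0. \<exists>as\<in>point_seqs xs A. (SUP b\<in>tuples ys (carr U). ?d \<phi> ys as b) < \<epsilon>) \<longleftrightarrow>
        (case p of (\<phi>, ys) \<Rightarrow>
          \<forall>\<epsilon>>0. \<exists>as\<in>point_seqs xs A. \<forall>b\<in>tuples ys (carr U). ?d \<phi> ys as b < \<epsilon>)"
      by (cases p) (simp only: prod.case eq)
  qed
qed

text \<open>Averages of points are Keisler measures, so convergence in the space of measures is pointwise
  convergence.\<close>

lemma sequentially_approximated_iff:
  assumes \<mu>: "\<mu> \<in> keisler L U xs" and A: "A \<subseteq> carr U"
  shows "sequentially_approximated L U xs A \<mu> \<longleftrightarrow>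
    (\<exists>as. (\<forall>i. as i \<in> point_seqs xs A) \<and>
      (\<forall>\<psi>\<in>formulas_over L xs (carr U). (\<lambda>i. Av L U xs (as i) \<psi>) \<longlonglongrightarrow> \<mu> \<psi>))"
proof -
  have ext: "\<nu> \<in> extensional (formulas_over L xs (carr U))" if "\<nu> \<in> keisler L U xs" for \<nu>
    using that by (simp add: keisler_def)
  have "limitin (keisler_space L U xs) (\<lambda>i. Av L U xs (as i)) \<mu> sequentially \<longleftrightarrow>
      (\<forall>\<psi>\<in>formulas_over L xs (carr U). (\<lambda>i. Av L U xs (as i) \<psi>) \<longlonglongrightarrow> \<mu> \<psi>)"
    if "\<forall>i. as i \<in> point_seqs xs A" for as
  proof -
    have "Av L U xs (as i) \<in> keisler L U xs" for i
      using Av_in_keisler[OF _ A] that by blast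
    then show ?thesis
      using \<mu> ext unfolding keisler_space_def limitin_subtopology limitin_componentwise
      by (simp add: PiE_iff limitin_canonical_iff)
  qed
  then show ?thesis
    unfolding sequentially_approximated_def by blast
qed


section \<open>Finite approximation implies definability\<close>

lemma continuous_map_locally_constant:
  fixes f :: "'a \<Rightarrow> real"
  assumes "\<And>x. x \<in> topspace X \<Longrightarrow> \<exists>W. openin X W \<and> x \<in> W \<and> (\<forall>y\<in>W. f y = f x)"
  shows "continuous_map X euclideanreal f"
  unfolding continuous_map_def
proof (intro conjI allI impI)
  fix V :: "real set"
  show "openin X {x \<in> topspace X. f x \<in> V}"
  proof (subst openin_subopen, intro ballI)
    fix x assume x: "x \<in> {x \<in> topspace X. f x \<in> V}"
    then obtain W where W: "openin X W" "x \<in> W" "\<forall>y\<in>W. f y = f x"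
      using assms by blast
    have "y \<in> {x \<in> topspace X. f x \<in> V}" if "y \<in> W" for y
    proof -
      have "f y = f x"
        using W(3) that by (rule bspec)
      then show ?thesis
        using openin_subset[OF W(1)] that x by (simp add: subset_iff)
    qed
    then show "\<exists>W. openin X W \<and> x \<in> W \<and> W \<subseteq> {x \<in> topspace X. f x \<in> V}"
      using W by blast
  qed
qed simp

text \<open>The realization of a type at which \<open>fiber_map\<close> evaluates the measure.\<close>

definition realization ::
  "('f, 'r, 'u) struct \<Rightarrow> nat list \<Rightarrow> ('f + 'u, 'r) fm set \<Rightarrow> 'u list" where
  "realization U ys q = (SOME b. realizes U ys b q)"

lemma fiber_map_realization: "fiber_map U \<mu> \<phi> ys q = \<mu> (plug ys \<phi> (realization U ys q))"
  by (simp add: fiber_map_def realization_def)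

definition types_realized ::
  "('f, 'r) lang \<Rightarrow> ('f, 'r, 'u) struct \<Rightarrow> nat list \<Rightarrow> 'u set \<Rightarrow> bool" where
  "types_realized L U ys A \<longleftrightarrow> (\<forall>q\<in>types L U ys A. \<exists>b. realizes U ys b q)"

lemma realization:
  assumes "types_realized L U ys A" "q \<in> types L U ys A"
  shows "realization U ys q \<in> tuples ys (carr U)" "tp L U ys A (realization U ys q) = q"
proof -
  have "realizes U ys (realization U ys q) q"
    using assms someI_ex[of "\<lambda>b. realizes U ys b q"] by (auto simp: types_realized_def realization_def)
  then show "realization U ys q \<in> tuples ys (carr U)" "tp L U ys A (realization U ys q) = q"
    using tp_realization[OF assms(2)] by (auto simp: realizes_def)
qed

text \<open>Types \<open>q\<close> that agree on the finitely many formulas \<open>\<phi>(a, y)\<close>, for \<open>a\<close> in the sequence, give the same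
  value, and this agreement defines a clopen set.\<close>

lemma continuous_map_fiber_map_Av:
  assumes real: "types_realized L U ys A"
    and \<phi>: "(\<phi>, ys) \<in> partitioned L xs" and as: "as \<in> point_seqs xs A"
  shows "continuous_map (type_space L U ys A) euclideanreal (fiber_map U (Av L U xs as) \<phi> ys)"
proof (rule continuous_map_locally_constant)
  fix q assume "q \<in> topspace (type_space L U ys A)"
  then have q: "q \<in> types L U ys A"
    by simp
  let ?V = "\<lambda>a. {p \<in> types L U ys A. plug xs \<phi> a \<in> p \<longleftrightarrow> plug xs \<phi> a \<in> q}"
  have form: "plug xs \<phi> a \<in> formulas_over L ys A" if "a \<in> set as" for a
    using as that by (intro plug_in_formulas_over[OF partitionedD(2)[OF \<phi>]]) (auto simp: point_seqs_def)
  have "openin (type_space L U ys A) (?V a)" if "a \<in> set as" for a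
  proof (cases "plug xs \<phi> a \<in> q")
    case True
    then have "?V a = {p \<in> types L U ys A. plug xs \<phi> a \<in> p}"
      by auto
    then show ?thesis
      using openin_type_space_basic[OF form[OF that]] by simp
  next
    case False
    then have "?V a = {p \<in> types L U ys A. Neg (plug xs \<phi> a) \<in> p}"
      using Neg_in_type_iff[OF _ form[OF that]] by auto
    moreover have "Neg (plug xs \<phi> a) \<in> formulas_over L ys A"
      using form[OF that] by simp
    ultimately show ?thesis
      by (simp only: openin_type_space_basic)
  qed
  moreover have "set as \<noteq> {}"
    using as by (auto simp: point_seqs_def)
  ultimately have "openin (type_space L U ys A) (\<Inter>(?V ` set as))"
    by (intro openin_Inter) auto
  moreover have "q \<in> \<Inter>(?V ` set as)"
    using q by simp
  moreover have "fiber_map U (Av L U xs as) \<phi> ys p = fiber_map U (Av L U xs as) \<phi> ys q"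
    if p: "p \<in> \<Inter>(?V ` set as)" for p
    unfolding fiber_map_realization
  proof -
    obtain a0 where "a0 \<in> set as"
      using \<open>set as \<noteq> {}\<close> by (meson ex_in_conv)
    then have p': "p \<in> types L U ys A"
      using p by simp
    show "Av L U xs as (plug ys \<phi> (realization U ys p)) = Av L U xs as (plug ys \<phi> (realization U ys q))"
    proof (rule Av_plug_cong[OF as \<phi> realization(1)[OF real p'] realization(1)[OF real q]])
      fix a assume a: "a \<in> set as"
      have "holds U ys (plug xs \<phi> a) (realization U ys r) \<longleftrightarrow> plug xs \<phi> a \<in> r"
        if "r \<in> types L U ys A" for r
        using realization(2)[OF real that] form[OF a] by (auto simp: tp_def)
      then show "holds U ys (plug xs \<phi> a) (realization U ys p) \<longleftrightarrow>
          holds U ys (plug xs \<phi> a) (realization U ys q)"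
        using p p' q a by auto
    qed
  qed
  ultimately show "\<exists>W. openin (type_space L U ys A) W \<and> q \<in> W \<and>
      (\<forall>p\<in>W. fiber_map U (Av L U xs as) \<phi> ys p = fiber_map U (Av L U xs as) \<phi> ys q)"
    by blast
qed

text \<open>Invariance and continuity both pass from averages of points of \<open>A\<close> to their uniform limits.\<close>

lemma definable_if_finitely_approximated:
  assumes fa: "finitely_approximated L U xs A \<mu>"
    and \<mu>: "\<mu> \<in> keisler L U xs" and U: "carr U \<noteq> {}" and A: "A \<subseteq> carr U"
    and real: "\<And>ys. distinct ys \<Longrightarrow> types_realized L U ys A"
  shows "definable L U xs A \<mu>"
proof -
  have approx: "\<exists>as\<in>point_seqs xs A. \<forall>b\<in>tuples ys (carr U).
      \<bar>\<mu> (plug ys \<phi> b) - Av L U xs as (plug ys \<phi> b)\<bar> < \<epsilon>"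
    if "(\<phi>, ys) \<in> partitioned L xs" "0 < \<epsilon>" for \<phi> ys \<epsilon>
    using fa that unfolding finitely_approximated_iff[OF \<mu> U A] by blast
  have inv: "\<mu> (plug ys \<phi> b) = \<mu> (plug ys \<phi> b')"
    if \<phi>: "(\<phi>, ys) \<in> partitioned L xs"
      and b: "b \<in> tuples ys (carr U)" and b': "b' \<in> tuples ys (carr U)"
      and tp: "tp L U ys A b = tp L U ys A b'" for \<phi> ys b b'
  proof (rule ccontr)
    assume "\<mu> (plug ys \<phi> b) \<noteq> \<mu> (plug ys \<phi> b')"
    then obtain \<delta> where \<delta>: "0 < \<delta>" "2 * \<delta> = \<bar>\<mu> (plug ys \<phi> b) - \<mu> (plug ys \<phi> b')\<bar>"
      by (intro that[of "\<bar>\<mu> (plug ys \<phi> b) - \<mu> (plug ys \<phi> b')\<bar> / 2"]) auto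
    obtain as where as: "as \<in> point_seqs xs A" and
      close: "\<And>c. c \<in> tuples ys (carr U) \<Longrightarrow> \<bar>\<mu> (plug ys \<phi> c) - Av L U xs as (plug ys \<phi> c)\<bar> < \<delta>"
      using approx[OF \<phi> \<delta>(1)] by blast
    show False
      using close[OF b] close[OF b'] Av_plug_tp_cong[OF as \<phi> b b' tp] \<delta>(2) by linarith
  qed
  have cont: "continuous_map (type_space L U ys A) (top_of_set {0..1}) (fiber_map U \<mu> \<phi> ys)"
    if \<phi>: "(\<phi>, ys) \<in> partitioned L xs" for \<phi> ys
  proof -
    have r: "types_realized L U ys A"
      by (rule real[OF partitionedD(3)[OF \<phi>]])
    define near where "near n as \<longleftrightarrow> as \<in> point_seqs xs A \<and> (\<forall>b\<in>tuples ys (carr U).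
        \<bar>\<mu> (plug ys \<phi> b) - Av L U xs as (plug ys \<phi> b)\<bar> < 1 / real (Suc n))" for n as
    have "\<exists>as. near n as" for n
      using approx[OF \<phi>, of "1 / real (Suc n)"] unfolding near_def by auto
    then obtain as where "\<forall>n. near n (as n)"
      using choice[of near] by blast
    then have as: "as n \<in> point_seqs xs A" and
      close: "\<And>b. b \<in> tuples ys (carr U) \<Longrightarrow>
        \<bar>\<mu> (plug ys \<phi> b) - Av L U xs (as n) (plug ys \<phi> b)\<bar> < 1 / real (Suc n)" for n
      unfolding near_def by blast+
    have "continuous_map (type_space L U ys A) Met_TC.mtopology (fiber_map U \<mu> \<phi> ys)"
    proof (rule Met_TC.continuous_map_uniform_limit)
      show "\<forall>\<^sub>F n in sequentially. continuous_map (type_space L U ys A) Met_TC.mtopology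
          (fiber_map U (Av L U xs (as n)) \<phi> ys)"
        using continuous_map_fiber_map_Av[OF r \<phi> as] by simp
      fix \<epsilon> :: real assume "0 < \<epsilon>"
      then have "\<forall>\<^sub>F n in sequentially. 1 / real (Suc n) < \<epsilon>"
        using order_tendstoD(2)[OF LIMSEQ_inverse_real_of_nat, of \<epsilon>] by (simp add: divide_inverse)
      then show "\<forall>\<^sub>F n in sequentially. \<forall>q\<in>topspace (type_space L U ys A).
          fiber_map U \<mu> \<phi> ys q \<in> UNIV \<and>
          dist (fiber_map U (Av L U xs (as n)) \<phi> ys q) (fiber_map U \<mu> \<phi> ys q) < \<epsilon>"
      proof eventually_elim
        case (elim n)
        have "dist (fiber_map U (Av L U xs (as n)) \<phi> ys q) (fiber_map U \<mu> \<phi> ys q) < \<epsilon>"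
          if "q \<in> types L U ys A" for q
          using close[OF realization(1)[OF r that], of n] elim
          by (simp add: fiber_map_realization dist_real_def abs_minus_commute)
        then show ?case
          by simp
      qed
    qed simp
    then have "continuous_map (type_space L U ys A) euclideanreal (fiber_map U \<mu> \<phi> ys)"
      by simp
    moreover have "fiber_map U \<mu> \<phi> ys q \<in> {0..1}" if "q \<in> types L U ys A" for q
      using keisler_bounds[OF \<mu>] plug_in_formulas_over[OF partitionedD(1)[OF \<phi>] realization(1)[OF r that]]
      by (simp add: fiber_map_realization)
    ultimately show ?thesis
      by (auto simp: continuous_map_in_subtopology)
  qed
  show ?thesis
    unfolding definable_def invariant_def
  proof (intro conjI ballI)
    fix p assume p: "p \<in> partitioned L xs"
    obtain \<phi> ys where eq: "p = (\<phi>, ys)"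
      by (cases p)
    have \<phi>: "(\<phi>, ys) \<in> partitioned L xs"
      using p unfolding eq .
    show "case p of (\<phi>, ys) \<Rightarrow> \<forall>b\<in>tuples ys (carr U). \<forall>b'\<in>tuples ys (carr U).
        tp L U ys A b = tp L U ys A b' \<longrightarrow> \<mu> (plug ys \<phi> b) = \<mu> (plug ys \<phi> b')"
      unfolding eq prod.case using inv[OF \<phi>] by blast
    show "case p of (\<phi>, ys) \<Rightarrow>
        continuous_map (type_space L U ys A) (top_of_set {0..1}) (fiber_map U \<mu> \<phi> ys)"
      unfolding eq prod.case by (rule cont[OF \<phi>])
  qed
qed

lemma invariantD:
  assumes "invariant L U xs A \<mu>" and \<phi>: "(\<phi>, ys) \<in> partitioned L xs"
    and "b \<in> tuples ys (carr U)" "b' \<in> tuples ys (carr U)" "tp L U ys A b = tp L U ys A b'"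
  shows "\<mu> (plug ys \<phi> b) = \<mu> (plug ys \<phi> b')"
proof -
  have "case (\<phi>, ys) of (\<phi>, ys) \<Rightarrow> \<forall>b\<in>tuples ys (carr U). \<forall>b'\<in>tuples ys (carr U).
      tp L U ys A b = tp L U ys A b' \<longrightarrow> \<mu> (plug ys \<phi> b) = \<mu> (plug ys \<phi> b')"
    using assms(1) \<phi> unfolding invariant_def by (rule bspec)
  then have "\<forall>b\<in>tuples ys (carr U). \<forall>b'\<in>tuples ys (carr U).
      tp L U ys A b = tp L U ys A b' \<longrightarrow> \<mu> (plug ys \<phi> b) = \<mu> (plug ys \<phi> b')"
    by (simp only: prod.case)
  from this[rule_format, OF assms(3-5)] show ?thesis .
qed


section \<open>Sequential approximation and definability imply finite approximation\<close>

text \<open>The distances between \<open>\<mu>\<close> and the approximating averages, as functions on the compact type space,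
  form a pointwise null sequence, so some midpoint combination of them is uniformly small.  By the
  triangle inequality the corresponding midpoint of averages is at least as close to \<open>\<mu>\<close>.\<close>

lemma finitely_approximated_if_sequentially_and_definable:
  assumes seq: "sequentially_approximated L U xs A \<mu>" and def: "definable L U xs A \<mu>"
    and \<mu>: "\<mu> \<in> keisler L U xs" and U: "carr U \<noteq> {}" and A: "A \<subseteq> carr U"
    and real: "\<And>ys. distinct ys \<Longrightarrow> types_realized L U ys A"
  shows "finitely_approximated L U xs A \<mu>"
  unfolding finitely_approximated_iff[OF \<mu> U A]
proof (clarify)
  fix \<phi> ys and \<epsilon> :: real assume \<phi>: "(\<phi>, ys) \<in> partitioned L xs" and "0 < \<epsilon>"
  let ?X = "type_space L U ys A"
  obtain as where as: "\<And>i. as i \<in> point_seqs xs A" and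
    lim: "\<And>\<psi>. \<psi> \<in> formulas_over L xs (carr U) \<Longrightarrow> (\<lambda>i. Av L U xs (as i) \<psi>) \<longlonglongrightarrow> \<mu> \<psi>"
    using seq unfolding sequentially_approximated_iff[OF \<mu> A] by blast
  have r: "types_realized L U ys A"
    by (rule real[OF partitionedD(3)[OF \<phi>]])
  define d where "d cs q = \<bar>fiber_map U (Av L U xs cs) \<phi> ys q - fiber_map U \<mu> \<phi> ys q\<bar>" for cs q
  have form: "plug ys \<phi> b \<in> formulas_over L xs (carr U)" if "b \<in> tuples ys (carr U)" for b
    by (rule plug_in_formulas_over[OF partitionedD(1)[OF \<phi>] that])
  have "continuous_map ?X (top_of_set {0..1}) (fiber_map U \<mu> \<phi> ys)"
    using def \<phi> unfolding definable_def by blast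
  then have cont_\<mu>: "continuous_map ?X euclideanreal (fiber_map U \<mu> \<phi> ys)"
    by (simp add: continuous_map_in_subtopology)
  have "\<exists>g\<in>midpoint_hull (range (\<lambda>i. d (as i))). \<forall>q\<in>topspace ?X. g q < \<epsilon>"
  proof (rule midpoint_hull_uniformly_small[OF compact_type_space _ _ _ \<open>0 < \<epsilon>\<close>])
    show "continuous_map ?X euclideanreal (d (as i))" for i
      unfolding d_def
      by (intro continuous_map_real_abs continuous_map_diff cont_\<mu> continuous_map_fiber_map_Av[OF r \<phi> as])
  next
    fix i q assume "q \<in> topspace ?X"
    then have "plug ys \<phi> (realization U ys q) \<in> formulas_over L xs (carr U)"
      using form realization(1)[OF r] by simp
    from keisler_bounds[OF \<mu> this] keisler_bounds[OF Av_in_keisler[OF as[of i] A] this]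
    show "0 \<le> d (as i) q \<and> d (as i) q \<le> 1"
      unfolding d_def fiber_map_realization by linarith
  next
    fix q assume "q \<in> topspace ?X"
    then have "plug ys \<phi> (realization U ys q) \<in> formulas_over L xs (carr U)"
      using form realization(1)[OF r] by simp
    then show "(\<lambda>i. d (as i) q) \<longlonglongrightarrow> 0"
      unfolding d_def fiber_map_realization by (intro tendsto_rabs_zero LIM_zero lim)
  qed
  then obtain g where g: "g \<in> midpoint_hull (range (\<lambda>i. d (as i)))"
    and g_small: "\<And>q. q \<in> types L U ys A \<Longrightarrow> g q < \<epsilon>"
    by auto
  from g have "\<exists>cs\<in>point_seqs xs A. \<forall>q\<in>types L U ys A. d cs q \<le> g q"
  proof (induction rule: midpoint_hull.induct)
    case (base f)
    then show ?case
      using as by blast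
  next
    case (mid f g)
    obtain cs cs' where cs: "cs \<in> point_seqs xs A" "\<And>q. q \<in> types L U ys A \<Longrightarrow> d cs q \<le> f q"
      and cs': "cs' \<in> point_seqs xs A" "\<And>q. q \<in> types L U ys A \<Longrightarrow> d cs' q \<le> g q"
      using mid.IH by blast
    obtain ds where ds: "ds \<in> point_seqs xs A" "\<And>\<psi>. \<psi> \<in> formulas_over L xs (carr U) \<Longrightarrow>
        Av L U xs ds \<psi> = (Av L U xs cs \<psi> + Av L U xs cs' \<psi>) / 2"
      using ex_Av_midpoint[OF cs(1) cs'(1)] by blast
    have "d ds q \<le> (f q + g q) / 2" if q: "q \<in> types L U ys A" for q
    proof -
      have "\<bar>(u + v) / 2 - m\<bar> \<le> (\<bar>u - m\<bar> + \<bar>v - m\<bar>) / 2" for u v m :: real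
      proof -
        have "(u + v) / 2 - m = ((u - m) + (v - m)) / 2"
          by (simp add: field_simps)
        then have "\<bar>(u + v) / 2 - m\<bar> = \<bar>(u - m) + (v - m)\<bar> / 2"
          by (simp only: abs_divide abs_numeral)
        also have "\<dots> \<le> (\<bar>u - m\<bar> + \<bar>v - m\<bar>) / 2"
          by (intro divide_right_mono abs_triangle_ineq) simp
        finally show ?thesis .
      qed
      then have "d ds q \<le> (d cs q + d cs' q) / 2"
        unfolding d_def fiber_map_realization ds(2)[OF form[OF realization(1)[OF r q]]] .
      also have "\<dots> \<le> (f q + g q) / 2"
        using cs(2)[OF q] cs'(2)[OF q] by simp
      finally show ?thesis .
    qed
    then show ?case
      using ds(1) by blast
  qed
  then obtain cs where cs: "cs \<in> point_seqs xs A" "\<And>q. q \<in> types L U ys A \<Longrightarrow> d cs q \<le> g q"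
    by blast
  have "\<bar>\<mu> (plug ys \<phi> b) - Av L U xs cs (plug ys \<phi> b)\<bar> < \<epsilon>" if b: "b \<in> tuples ys (carr U)" for b
  proof -
    define q where "q = tp L U ys A b"
    have q: "q \<in> types L U ys A"
      unfolding q_def by (rule tp_in_types[OF b])
    have tp: "tp L U ys A (realization U ys q) = tp L U ys A b"
      using realization(2)[OF r q] by (simp add: q_def)
    have "\<mu> (plug ys \<phi> (realization U ys q)) = \<mu> (plug ys \<phi> b)"
      using def by (intro invariantD[OF _ \<phi> realization(1)[OF r q] b tp]) (simp add: definable_def)
    moreover have "Av L U xs cs (plug ys \<phi> (realization U ys q)) = Av L U xs cs (plug ys \<phi> b)"
      by (rule Av_plug_tp_cong[OF cs(1) \<phi> realization(1)[OF r q] b tp])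
    ultimately show ?thesis
      using cs(2)[OF q] g_small[OF q] by (simp add: d_def fiber_map_realization abs_minus_commute)
  qed
  then show "\<exists>as\<in>point_seqs xs A. \<forall>b\<in>tuples ys (carr U).
      \<bar>\<mu> (plug ys \<phi> b) - Av L U xs as (plug ys \<phi> b)\<bar> < \<epsilon>"
    using cs(1) by blast
qed


section \<open>Finite approximation implies sequential approximation\<close>

text \<open>The family of sets defined by \<open>\<phi>(x, b)\<close>, as \<open>b\<close> varies.  A Keisler measure sees a formula only
  through the set that it defines, so approximating a formula uniformly takes care of every formula
  whose family is contained in its own.\<close>

definition instances ::
  "('f, 'r, 'u) struct \<Rightarrow> nat list \<Rightarrow> ('f, 'r) fm \<times> nat list \<Rightarrow> 'u list set set" where
  "instances U xs = (\<lambda>(\<phi>, ys).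
    (\<lambda>b. {a \<in> tuples xs (carr U). holds U xs (plug ys \<phi> b) a}) ` tuples ys (carr U))"

lemma assign_in_set: "v \<in> set ys \<Longrightarrow> length b = length ys \<Longrightarrow> assign ys b v \<in> set b"
proof -
  assume "v \<in> set ys" "length b = length ys"
  then obtain u where "map_of (zip ys b) v = Some u"
    using map_of_zip_is_Some[of ys b v] by auto
  then show ?thesis
    using set_zip_rightD[OF map_of_SomeD] by (force simp: assign_def)
qed

text \<open>With new variables \<open>z\<close> and \<open>w\<close>, use \<open>(z = w \<and> \<phi>\<^sub>1) \<or> (z \<noteq> w \<and> \<phi>\<^sub>2)\<close>.  The values of \<open>z\<close> and \<open>w\<close>
  select one of the two formulas; this needs two different elements.\<close>

lemma ex_common_instances:
  assumes cd: "c \<in> carr U" "d \<in> carr U" "c \<noteq> d"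
    and 1: "(\<phi>1, ys1) \<in> partitioned L xs" and 2: "(\<phi>2, ys2) \<in> partitioned L xs"
  shows "\<exists>p\<in>partitioned L xs. instances U xs (\<phi>1, ys1) \<union> instances U xs (\<phi>2, ys2) \<subseteq> instances U xs p"
proof -
  let ?V = "set xs \<union> set ys1 \<union> set ys2"
  obtain z where z: "z \<notin> ?V"
    using ex_new_if_finite[OF infinite_UNIV_nat, of ?V] by auto
  obtain w where w: "w \<notin> insert z ?V"
    using ex_new_if_finite[OF infinite_UNIV_nat, of "insert z ?V"] by auto
  define zs where "zs = z # w # remdups (ys1 @ ys2)"
  define \<theta> where "\<theta> = Disj (Conj (Eq (Var z) (Var w)) \<phi>1) (Conj (Neg (Eq (Var z) (Var w))) \<phi>2)"
  have set_zs: "set zs = insert z (insert w (set ys1 \<union> set ys2))"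
    by (simp add: zs_def)
  have p: "(\<theta>, zs) \<in> partitioned L xs"
    using 1 2 z w by (auto simp: partitioned_def formulas_def \<theta>_def zs_def)
  \<comment> \<open>The assignment \<open>e\<close> gives \<open>ys\<close> the values \<open>b\<close>, and it makes \<open>z\<close> and \<open>w\<close> equal exactly in order
    to select \<open>\<phi>1\<close>.  The remaining variables of \<open>zs\<close> get the arbitrary value \<open>c\<close>.\<close>
  have inst: "{a \<in> tuples xs (carr U). holds U xs (plug ys \<phi> b) a} \<in> instances U xs (\<theta>, zs)"
    if i: "(\<phi>, ys) \<in> partitioned L xs" and b: "b \<in> tuples ys (carr U)"
      and ys: "set ys \<subseteq> set ys1 \<union> set ys2"
      and e: "e z = c" "e w \<in> {c, d}" "\<And>v. v \<in> set ys \<Longrightarrow> e v = assign ys b v"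
        "\<And>v. v \<notin> set ys \<Longrightarrow> v \<noteq> z \<Longrightarrow> v \<noteq> w \<Longrightarrow> e v = c"
      and \<phi>: "\<phi> = (if e w = c then \<phi>1 else \<phi>2)" for \<phi> ys b e
  proof -
    have "e v \<in> carr U" for v
      using e cd assign_in_set[of v ys b] b
      by (cases "v \<in> set ys"; cases "v = z"; cases "v = w") (auto simp: nlists_iff)
    then have e_tuple: "map e zs \<in> tuples zs (carr U)"
      by (auto simp: nlists_iff)
    have "holds U xs (plug zs \<theta> (map e zs)) a \<longleftrightarrow> holds U xs (plug ys \<phi> b) a" for a
    proof -
      let ?E = "\<lambda>v. if v \<in> set zs then assign zs (map e zs) v else assign xs a v"
      have E: "?E v = (if v \<in> set zs then e v else assign xs a v)" for v
        by (simp add: assign_map)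
      have "holds U xs (plug zs \<theta> (map e zs)) a \<longleftrightarrow> sat U ?E \<theta>"
        by (rule holds_plug) simp
      also have "\<dots> \<longleftrightarrow> sat U ?E \<phi>"
        using e(1,2) cd(3) unfolding \<phi> \<theta>_def by (auto simp: assign_map set_zs)
      also have "\<dots> \<longleftrightarrow> sat U (\<lambda>v. if v \<in> set ys then assign ys b v else assign xs a v) \<phi>"
      proof (rule sat_cong)
        fix v assume "v \<in> fv \<phi>"
        then have "v \<in> set xs \<union> set ys"
          using i by (auto simp: partitioned_def formulas_def)
        moreover have "v \<notin> set zs" if "v \<in> set xs"
          using p that by (auto simp: partitioned_def)
        moreover have "v \<in> set zs" if "v \<in> set ys"
          using ys that by (auto simp: set_zs)
        ultimately show "?E v = (if v \<in> set ys then assign ys b v else assign xs a v)"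
          unfolding E using e(3) by auto
      qed
      also have "\<dots> \<longleftrightarrow> holds U xs (plug ys \<phi> b) a"
        by (rule holds_plug[symmetric]) (use b in \<open>simp add: nlists_iff\<close>)
      finally show ?thesis .
    qed
    then show ?thesis
      unfolding instances_def prod.case by (intro image_eqI[OF _ e_tuple]) simp
  qed
  have "instances U xs (\<phi>1, ys1) \<subseteq> instances U xs (\<theta>, zs)"
  proof -
    have "{a \<in> tuples xs (carr U). holds U xs (plug ys1 \<phi>1 b) a} \<in> instances U xs (\<theta>, zs)"
      if "b \<in> tuples ys1 (carr U)" for b
      using z w by (intro inst[OF 1 that, of "\<lambda>v. if v \<in> set ys1 then assign ys1 b v else c"]) auto
    then show ?thesis
      by (auto simp: instances_def)
  qed
  moreover have "instances U xs (\<phi>2, ys2) \<subseteq> instances U xs (\<theta>, zs)"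
  proof -
    have "{a \<in> tuples xs (carr U). holds U xs (plug ys2 \<phi>2 b) a} \<in> instances U xs (\<theta>, zs)"
      if "b \<in> tuples ys2 (carr U)" for b
      using z w cd(3)
      by (intro inst[OF 2 that, of "\<lambda>v. if v \<in> set ys2 then assign ys2 b v else if v = w then d else c"])
        auto
    then show ?thesis
      by (auto simp: instances_def)
  qed
  ultimately show ?thesis
    using p by blast
qed

lemma ex_common_instances_finite:
  assumes cd: "c \<in> carr U" "d \<in> carr U" "c \<noteq> d"
    and "finite F" "F \<subseteq> partitioned L xs"
  shows "\<exists>p\<in>partitioned L xs. \<Union>(instances U xs ` F) \<subseteq> instances U xs p"
  using assms(4,5)
proof (induction rule: finite_induct)
  case empty
  have "(Tru, []) \<in> partitioned L xs"
    by (simp add: partitioned_def)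
  then show ?case
    by auto
next
  case (insert r F)
  then obtain p where p: "p \<in> partitioned L xs" "\<Union>(instances U xs ` F) \<subseteq> instances U xs p"
    by auto
  obtain p' where "p' \<in> partitioned L xs" "instances U xs r \<union> instances U xs p \<subseteq> instances U xs p'"
    using ex_common_instances[OF cd, of "fst r" "snd r" L xs "fst p" "snd p"] insert.prems p(1) by auto
  then show ?case
    using p(2) by (intro bexI[of _ p']) auto
qed

text \<open>There is only one point, so every formula is equivalent to \<open>Tru\<close> or to \<open>Fls\<close>.\<close>

lemma keisler_unique_if_singleton:
  assumes \<mu>: "\<mu> \<in> keisler L U xs" and \<nu>: "\<nu> \<in> keisler L U xs"
    and u: "carr U = {u}" and \<psi>: "\<psi> \<in> formulas_over L xs (carr U)"
  shows "\<mu> \<psi> = \<nu> \<psi>"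
proof -
  let ?a = "replicate (length xs) u"
  have "tuples xs (carr U) = {?a}"
    by (simp add: u nlists_singleton)
  then have tuples: "a = ?a" if "a \<in> tuples xs (carr U)" for a
    using that by simp
  have determined: "\<rho> \<psi> = (if holds U xs \<psi> ?a then 1 else 0)" if \<rho>: "\<rho> \<in> keisler L U xs" for \<rho>
  proof -
    have Tru: "\<rho> Tru = 1"
      using \<rho> by (simp add: keisler_def)
    show ?thesis
    proof (cases "holds U xs \<psi> ?a")
      case True
      have "\<rho> \<psi> = \<rho> Tru"
        by (rule keisler_eq_if_equivalent[OF \<rho> \<psi>]) (use True tuples in auto)
      then show ?thesis
        using True Tru by simp
    next
      case False
      have "\<rho> \<psi> = \<rho> Fls"
        by (rule keisler_eq_if_equivalent[OF \<rho> \<psi>]) (use False tuples in auto)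
      also have "\<dots> = 0"
        using keisler_Neg[OF \<rho>, of Tru] Tru by simp
      finally show ?thesis
        using False by simp
    qed
  qed
  show ?thesis
    by (simp only: determined[OF \<mu>] determined[OF \<nu>])
qed

text \<open>If \<open>U\<close> has two elements, approximate a single formula that has the instances of all formulas in
  \<open>F\<close>.  If it has only one, every average of points equals \<open>\<mu>\<close>.\<close>

lemma approximates_finitely_many:
  assumes fa: "finitely_approximated L U xs A \<mu>"
    and \<mu>: "\<mu> \<in> keisler L U xs" and U: "carr U \<noteq> {}" and A: "A \<subseteq> carr U"
    and F: "finite F" "F \<subseteq> partitioned L xs" and "0 < \<epsilon>"
  shows "\<exists>as\<in>point_seqs xs A. \<forall>(\<phi>, ys)\<in>F. \<forall>b\<in>tuples ys (carr U).
    \<bar>\<mu> (plug ys \<phi> b) - Av L U xs as (plug ys \<phi> b)\<bar> < \<epsilon>"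
proof -
  have approx: "\<exists>as\<in>point_seqs xs A. \<forall>b\<in>tuples ys (carr U).
      \<bar>\<mu> (plug ys \<phi> b) - Av L U xs as (plug ys \<phi> b)\<bar> < \<epsilon>"
    if "(\<phi>, ys) \<in> partitioned L xs" for \<phi> ys
    using fa that \<open>0 < \<epsilon>\<close> unfolding finitely_approximated_iff[OF \<mu> U A] by blast
  have form: "plug ys \<phi> b \<in> formulas_over L xs (carr U)"
    if "(\<phi>, ys) \<in> partitioned L xs" "b \<in> tuples ys (carr U)" for \<phi> ys b
    using that by (intro plug_in_formulas_over[OF partitionedD(1)])
  show ?thesis
  proof (cases "\<exists>c d. c \<in> carr U \<and> d \<in> carr U \<and> c \<noteq> d")
    case True
    then obtain \<theta> zs where \<theta>: "(\<theta>, zs) \<in> partitioned L xs"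
      and inst: "\<Union>(instances U xs ` F) \<subseteq> instances U xs (\<theta>, zs)"
      using ex_common_instances_finite[OF _ _ _ F] by (metis surj_pair)
    obtain as where as: "as \<in> point_seqs xs A" and
      close: "\<And>e. e \<in> tuples zs (carr U) \<Longrightarrow> \<bar>\<mu> (plug zs \<theta> e) - Av L U xs as (plug zs \<theta> e)\<bar> < \<epsilon>"
      using approx[OF \<theta>] by blast
    have "\<bar>\<mu> (plug ys \<phi> b) - Av L U xs as (plug ys \<phi> b)\<bar> < \<epsilon>"
      if \<phi>: "(\<phi>, ys) \<in> F" and b: "b \<in> tuples ys (carr U)" for \<phi> ys b
    proof -
      have p: "(\<phi>, ys) \<in> partitioned L xs"
        using F \<phi> by blast
      have "{a \<in> tuples xs (carr U). holds U xs (plug ys \<phi> b) a} \<in> instances U xs (\<phi>, ys)"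
        using b by (auto simp: instances_def)
      then have "{a \<in> tuples xs (carr U). holds U xs (plug ys \<phi> b) a} \<in> instances U xs (\<theta>, zs)"
        using inst \<phi> by blast
      then obtain e where e: "e \<in> tuples zs (carr U)"
        and eq: "{a \<in> tuples xs (carr U). holds U xs (plug ys \<phi> b) a} =
          {a \<in> tuples xs (carr U). holds U xs (plug zs \<theta> e) a}"
        by (auto simp: instances_def)
      have same: "\<rho> (plug ys \<phi> b) = \<rho> (plug zs \<theta> e)" if "\<rho> \<in> keisler L U xs" for \<rho>
        by (rule keisler_eq_if_equivalent[OF that form[OF p b] form[OF \<theta> e]]) (use eq in blast)
      show ?thesis
        using close[OF e] same[OF \<mu>] same[OF Av_in_keisler[OF as A]] by simp
    qed
    then show ?thesis
      using as by blast
  next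
    case False
    then obtain u where u: "carr U = {u}"
      using U by blast
    obtain as where as: "as \<in> point_seqs xs A"
      using approx[of Tru "[]"] by (auto simp: partitioned_def)
    have "\<mu> (plug ys \<phi> b) = Av L U xs as (plug ys \<phi> b)"
      if "(\<phi>, ys) \<in> F" "b \<in> tuples ys (carr U)" for \<phi> ys b
      by (rule keisler_unique_if_singleton[OF \<mu> Av_in_keisler[OF as A] u])
        (use form F that in blast)
    then show ?thesis
      using as \<open>0 < \<epsilon>\<close> by (intro bexI[of _ as]) auto
  qed
qed

text \<open>The \<open>n\<close>-th sequence of points approximates the first \<open>n + 1\<close> formulas of an enumeration within
  \<open>1 / (n + 1)\<close>.  A given formula with parameters is an instance of one formula of the enumeration,
  hence is taken care of from some \<open>n\<close> on.\<close>

lemma sequentially_approximated_if_finitely_approximated: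
  assumes fa: "finitely_approximated L U xs A \<mu>"
    and \<mu>: "\<mu> \<in> keisler L U xs" and U: "carr U \<noteq> {}" and A: "A \<subseteq> carr U"
    and L: "countable (funs L)" "countable (rels L)"
  shows "sequentially_approximated L U xs A \<mu>"
proof -
  have "(Tru, []) \<in> partitioned L xs"
    by (simp add: partitioned_def)
  then have ne: "partitioned L xs \<noteq> {}"
    by blast
  define F where "F n = from_nat_into (partitioned L xs) ` {..n}" for n
  have F: "F n \<subseteq> partitioned L xs" "finite (F n)" for n
    using from_nat_into[OF ne] by (auto simp: F_def)
  define near where "near n as \<longleftrightarrow> as \<in> point_seqs xs A \<and>
      (\<forall>(\<phi>, ys)\<in>F n. \<forall>b\<in>tuples ys (carr U).
        \<bar>\<mu> (plug ys \<phi> b) - Av L U xs as (plug ys \<phi> b)\<bar> < 1 / real (Suc n))" for n as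
  have "\<exists>as. near n as" for n
    using approximates_finitely_many[OF fa \<mu> U A F(2)[of n] F(1)[of n], of "1 / real (Suc n)"]
    unfolding near_def by auto
  then obtain as where "\<forall>n. near n (as n)"
    using choice[of near] by blast
  then have as: "as n \<in> point_seqs xs A" and
    close: "\<forall>(\<phi>, ys)\<in>F n. \<forall>b\<in>tuples ys (carr U).
      \<bar>\<mu> (plug ys \<phi> b) - Av L U xs (as n) (plug ys \<phi> b)\<bar> < 1 / real (Suc n)" for n
    unfolding near_def by blast+
  have "(\<lambda>n. Av L U xs (as n) \<psi>) \<longlonglongrightarrow> \<mu> \<psi>" if "\<psi> \<in> formulas_over L xs (carr U)" for \<psi>
  proof -
    obtain \<phi> ys b where \<phi>: "(\<phi>, ys) \<in> partitioned L xs" and b: "b \<in> tuples ys (carr U)"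
      and \<psi>: "plug ys \<phi> b = \<psi>"
      using ex_plug[OF \<open>\<psi> \<in> _\<close>] by blast
    obtain m where "from_nat_into (partitioned L xs) m = (\<phi>, ys)"
      using from_nat_into_surj[OF countable_partitioned[OF L] \<phi>] by blast
    then have "(\<phi>, ys) \<in> F n" if "m \<le> n" for n
      using that by (force simp: F_def)
    then have "\<bar>Av L U xs (as n) \<psi> - \<mu> \<psi>\<bar> \<le> inverse (real (Suc n))" if "m \<le> n" for n
      using close[of n] b that unfolding \<psi>[symmetric]
      by (fastforce simp: abs_minus_commute inverse_eq_divide)
    then have "\<forall>\<^sub>F n in sequentially. norm (Av L U xs (as n) \<psi> - \<mu> \<psi>) \<le> inverse (real (Suc n))"
      unfolding eventually_sequentially real_norm_def by blast
    then have "(\<lambda>n. Av L U xs (as n) \<psi> - \<mu> \<psi>) \<longlonglongrightarrow> 0"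
      by (rule Lim_null_comparison[OF _ LIMSEQ_inverse_real_of_nat])
    then show ?thesis
      by (rule LIM_zero_cancel)
  qed
  then show ?thesis
    unfolding sequentially_approximated_iff[OF \<mu> A] using as by blast
qed


section \<open>The equivalence\<close>

theorem proposition3p4:
  fixes L :: "('f, 'r) lang" and T :: "('f, 'r) fm set"
    and U M :: "('f, 'r, 'u) struct" and \<kappa> :: "'k rel"
    and xs :: "nat list" and \<mu> :: "('f + 'u, 'r) fm \<Rightarrow> real"
  assumes "countable (funs L)" and "countable (rels L)"
    and "complete_theory L T"
    and "monster \<kappa> L T U"
    and "elem_substruct L M U" and "|carr M| <o \<kappa>"
    and "distinct xs"
    and "\<mu> \<in> keisler L U xs"
  shows "sequentially_approximated L U xs (carr M) \<mu> \<and> definable L U xs (carr M) \<mu>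
     \<longleftrightarrow> finitely_approximated L U xs (carr M) \<mu>"
proof -
  have U: "carr U \<noteq> {}"
    using assms(4) by (simp add: monster_def is_struct_def)
  have M: "carr M \<subseteq> carr U"
    using assms(5) by (simp add: elem_substruct_def)
  have "saturated \<kappa> L U"
    using assms(4) by (simp add: monster_def)
  then have real: "types_realized L U ys (carr M)" if "distinct ys" for ys
    using M assms(6) that unfolding saturated_def types_realized_def by blast
  show ?thesis
    using finitely_approximated_if_sequentially_and_definable[OF _ _ assms(8) U M real]
      sequentially_approximated_if_finitely_approximated[OF _ assms(8) U M assms(1,2)]
      definable_if_finitely_approximated[OF _ assms(8) U M real]
    by blast
qed

end
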